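(* Let $X_0\subset\operatorname{dom}F$, $Y_0\subset\operatorname{dom}G$ be bounded and such that $X_0\times Y_0$ contains a saddle-point of $L$. Let $\sigma,\tau>0$, $(\bar x^0,\bar y^0)\in X\times Y$, and let $\{(x^k,y^k)\}_{k\ge1}$ be generated by the Douglas--Rachford iteration (DR). Then $(x^k,y^k)$ converges weakly to some saddle-point $(x^*,y^* )$, and, in addition, the ergodic sequences $$x^k_{\mathrm{erg}}=\frac1k\sum_{k'=1}^kx^{k'},\qquad y^k_{\mathrm{erg}}=\frac1k\sum_{k'=1}^ky^{k'}$$ converge weakly to $x^*$ and $y^*$, respectively, and the restricted primal-dual gap obeys, for all $k\ge1$, $$\mathfrak G_{X_0\times Y_0}(x^k_{\mathrm{erg}},y^k_{\mathrm{erg}})\le\frac1k\sup_{(x,y)\in X_0\times Y_0}\Bigl[\frac{\|\bar x^0-x+\sigma K^*y\|^2}{2\sigma}+\frac{\|\bar y^0-y-\tau Kx\|^2}{2\tau}\Bigr]=O(1/k).$$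
   Context: $X,Y$ are real Hilbert spaces, $K:X\to Y$ is linear and continuous with adjoint $K^*$, and $F:X\to(-\infty,\infty]$, $G:Y\to(-\infty,\infty]$ are proper, convex and lower semi-continuous. $L(x,y)=\langle Kx,y\rangle+F(x)-G(y)$ on $\operatorname{dom}F\times\operatorname{dom}G$; a saddle-point is $(x^*,y^* )\in\operatorname{dom}F\times\operatorname{dom}G$ with $L(x^*,y)\le L(x^*,y^* )\le L(x,y^* )$ for all $(x,y)\in\operatorname{dom}F\times\operatorname{dom}G$. Restricted primal-dual gap: $\mathfrak G_{X_0\times Y_0}(x,y)=\sup_{(x',y')\in X_0\times Y_0}\,[L(x,y')-L(x',y)]$. Iteration (DR), for $k\ge0$: $x^{k+1}=(\mathrm{id}+\sigma\partial F)^{-1}(\bar x^k)$, $y^{k+1}=(\mathrm{id}+\tau\partial G)^{-1}(\bar y^k)$, $b^{k+1}=(2x^{k+1}-\bar x^k)-\sigma K^*(2y^{k+1}-\bar y^k)$, $d^{k+1}=(\mathrm{id}+\sigma\tau K^*K)^{-1}b^{k+1}$, $\bar x^{k+1}=\bar x^k-x^{k+1}+d^{k+1}$, $\bar y^{k+1}=y^{k+1}+\tau Kd^{k+1}$. Equivalently, $\bar x^{k+1}=x^{k+1}-\sigma K^*(y^{k+1}+\bar y^{k+1}-\bar y^k)$ and $\bar y^{k+1}=y^{k+1}+\tau K(x^{k+1}+\bar x^{k+1}-\bar x^k)$. Here $(\mathrm{id}+\sigma\partial F)^{-1}$ denotes the resolvent (proximal map) of the subdifferential. *)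

theory Defs
  imports "HOL-Analysis.Analysis" "HOL-Library.Landau_Symbols"
begin

definition effective_domain :: "('a \<Rightarrow> ereal) \<Rightarrow> 'a set" where
  "effective_domain F = {x. F x < \<infinity>}"

definition proper_fun :: "('a \<Rightarrow> ereal) \<Rightarrow> bool" where
  "proper_fun F \<longleftrightarrow> (\<forall>x. F x \<noteq> -\<infinity>) \<and> effective_domain F \<noteq> {}"

definition convex_fun :: "('a::real_vector \<Rightarrow> ereal) \<Rightarrow> bool" where
  "convex_fun F \<longleftrightarrow> (\<forall>x y. \<forall>t\<in>{0<..<1}.
     F ((1 - t) *\<^sub>R x + t *\<^sub>R y) \<le> ereal (1 - t) * F x + ereal t * F y)"

definition lower_semicontinuous :: "('a::topological_space \<Rightarrow> ereal) \<Rightarrow> bool" where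
  "lower_semicontinuous F \<longleftrightarrow> (\<forall>x. F x \<le> Liminf (at x) F)"

definition subdifferential :: "('a::real_inner \<Rightarrow> ereal) \<Rightarrow> 'a \<Rightarrow> 'a set" where
  "subdifferential F x = {p. \<forall>z. F x + ereal (inner p (z - x)) \<le> F z}"

text \<open>
  For \<open>s > 0\<close> and \<open>F\<close> proper, convex and lower semicontinuous on a Hilbert space, the
  set-valued inverse of \<open>id + s \<partial>F\<close> is single-valued and everywhere defined, so
  the description below denotes its value.
\<close>

definition resolvent :: "real \<Rightarrow> ('a::real_vector \<Rightarrow> 'a set) \<Rightarrow> 'a \<Rightarrow> 'a" where
  "resolvent s A u = (THE x. \<exists>p\<in>A x. u = x + s *\<^sub>R p)"

definition weakly_converges_to :: "(nat \<Rightarrow> 'a::real_normed_vector) \<Rightarrow> 'a \<Rightarrow> bool" where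
  "weakly_converges_to u l \<longleftrightarrow>
     (\<forall>f::'a \<Rightarrow> real. bounded_linear f \<longrightarrow> (\<lambda>n. f (u n)) \<longlonglongrightarrow> f l)"

text \<open>
  For proper \<open>F\<close>, \<open>G\<close> the value is finite exactly on the product of the effective domains.
  Because \<open>\<infinity> - \<infinity> = \<infinity>\<close> for ereal, the gap below is \<open>\<infinity>\<close> when \<open>(x, y)\<close> lies outside
  that product and \<open>X0 \<times> Y0\<close> is a nonempty subset of it.
\<close>

definition lagrangian ::
  "('a::real_inner \<Rightarrow> 'b::real_inner) \<Rightarrow> ('a \<Rightarrow> ereal) \<Rightarrow> ('b \<Rightarrow> ereal) \<Rightarrow> 'a \<Rightarrow> 'b \<Rightarrow> ereal" where
  "lagrangian K F G x y = ereal (inner (K x) y) + F x - G y"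

definition saddle_point ::
  "('a::real_inner \<Rightarrow> 'b::real_inner) \<Rightarrow> ('a \<Rightarrow> ereal) \<Rightarrow> ('b \<Rightarrow> ereal) \<Rightarrow> 'a \<Rightarrow> 'b \<Rightarrow> bool" where
  "saddle_point K F G xs ys \<longleftrightarrow>
     xs \<in> effective_domain F \<and> ys \<in> effective_domain G \<and>
     (\<forall>x\<in>effective_domain F. \<forall>y\<in>effective_domain G.
        lagrangian K F G xs y \<le> lagrangian K F G xs ys \<and>
        lagrangian K F G xs ys \<le> lagrangian K F G x ys)"

definition restricted_gap ::
  "('a::real_inner \<Rightarrow> 'b::real_inner) \<Rightarrow> ('a \<Rightarrow> ereal) \<Rightarrow> ('b \<Rightarrow> ereal) \<Rightarrow>
     'a set \<Rightarrow> 'b set \<Rightarrow> 'a \<Rightarrow> 'b \<Rightarrow> ereal" where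
  "restricted_gap K F G X0 Y0 x y =
     (SUP (x', y')\<in>X0 \<times> Y0. lagrangian K F G x y' - lagrangian K F G x' y)"

definition ergodic_mean :: "(nat \<Rightarrow> 'a::real_vector) \<Rightarrow> nat \<Rightarrow> 'a" where
  "ergodic_mean u k = (1 / real k) *\<^sub>R (\<Sum>j = 1..k. u j)"

definition gap_bound ::
  "('a::real_inner \<Rightarrow> 'b::real_inner) \<Rightarrow> real \<Rightarrow> real \<Rightarrow> 'a \<Rightarrow> 'b \<Rightarrow>
     'a set \<Rightarrow> 'b set \<Rightarrow> nat \<Rightarrow> ereal" where
  "gap_bound K \<sigma> \<tau> x0 y0 X0 Y0 k = ereal (1 / real k) *
     (SUP (x, y)\<in>X0 \<times> Y0. ereal (
        (norm (x0 - x + \<sigma> *\<^sub>R adjoint K y))\<^sup>2 / (2 * \<sigma>) +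
        (norm (y0 - y - \<tau> *\<^sub>R K x))\<^sup>2 / (2 * \<tau>)))"

end

theory Submission
  imports Defs
begin

text \<open>
  Put \<open>P = p - \<sigma> K\<^sup>* q\<close> and \<open>Q = q + \<tau> K p\<close> for a pair \<open>(p, q)\<close>. In the implicit form of the
  iteration, the subgradient inequalities of \<open>F\<close> and \<open>G\<close> at the new iterates add up, with all
  bilinear terms cancelling, to
  \<open>L(x\<^sup>k\<^sup>+\<^sup>1, q) - L(p, y\<^sup>k\<^sup>+\<^sup>1) \<le> \<langle>dx, xbar\<^sup>k\<^sup>+\<^sup>1 - P\<rangle> / \<sigma> + \<langle>dy, ybar\<^sup>k\<^sup>+\<^sup>1 - Q\<rangle> / \<tau>\<close>,
  where \<open>dx\<close>, \<open>dy\<close> are the decrements of \<open>xbar\<close>, \<open>ybar\<close> (lemma \<open>one_step_gap\<close>). So in the variables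
  \<open>(xbar, ybar)\<close> the method is a proximal point iteration, and polarization turns the right-hand side
  into the decrease of the energy \<open>\<parallel>xbar - P\<parallel>\<^sup>2 / (2\<sigma>) + \<parallel>ybar - Q\<parallel>\<^sup>2 / (2\<tau>)\<close> minus
  \<open>\<parallel>dx\<parallel>\<^sup>2 / (2\<sigma>) + \<parallel>dy\<parallel>\<^sup>2 / (2\<tau>)\<close> (lemma \<open>one_step_energy\<close>). Everything follows from these two estimates.

  \<^item> Rate: the energies telescope, and convexity of \<open>F\<close> and \<open>G\<close> passes the averaged gap to the ergodic
    means (lemma \<open>ergodic_gap\<close>). The initial energy is the quantity whose supremum is the bound.

  \<^item> Weak convergence: for a saddle point \<open>(p, q)\<close> the gap is nonnegative, so the energy decreases, the
    iterates stay bounded, and \<open>dx\<close>, \<open>dy\<close> tend to zero. Hence the right-hand side of the first estimate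
    tends to zero, and weak lower semicontinuity makes every weak cluster point a saddle point
    (lemma \<open>weak_cluster_point_saddle\<close>). By Opial's argument there is only one: for two cluster points both
    energies converge, and their difference is affine in \<open>(xbar, ybar)\<close>, so its limits along the two
    cluster filters must agree, which forces the shifted points to coincide
    (lemma \<open>weak_cluster_point_unique\<close>). The ergodic means follow by Cesaro summation.

  The Hilbert space tools all come from one source, the existence of the minimizer of
  \<open>F + \<parallel>\<cdot> - u\<parallel>\<^sup>2 / (2s)\<close>. It gives the resolvents, and, for suitable choices of \<open>F\<close>, the Riesz representation
  theorem (\<open>F\<close> linear), the inverse of \<open>id + c K\<^sup>* K\<close> (\<open>F\<close> quadratic) and the weak closedness of closed
  convex sets (\<open>F\<close> an indicator function). Weak cluster points are taken along
  filters finer than the sequential one and exist by Tychonoff's theorem, so the argument is the same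
  in separable and nonseparable spaces.
\<close>

section \<open>Extended-valued convex functions\<close>

lemma lower_semicontinuous_eventually:
  fixes F :: "'a::topological_space \<Rightarrow> ereal"
  assumes "lower_semicontinuous F" "\<alpha> < F x"
  shows "eventually (\<lambda>z. \<alpha> < F z) (nhds x)"
proof -
  have "F x \<le> Liminf (at x) F"
    using assms(1) by (simp add: lower_semicontinuous_def)
  then have "eventually (\<lambda>z. \<alpha> < F z) (at x)"
    using assms(2) by (intro less_LiminfD) (rule order.strict_trans2)
  then show ?thesis
    using assms(2) eventually_at_filter[of "\<lambda>z. \<alpha> < F z" x UNIV]
    by (auto elim!: eventually_mono)
qed

lemma lower_semicontinuousI:
  assumes "\<And>x \<alpha>. \<alpha> < F x \<Longrightarrow> eventually (\<lambda>z. \<alpha> < F z) (nhds x)"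
  shows "lower_semicontinuous F"
  unfolding lower_semicontinuous_def le_Liminf_iff
proof (intro allI impI)
  fix x \<alpha> assume "\<alpha> < F x"
  from assms[OF this] show "eventually (\<lambda>z. \<alpha> < F z) (at x)"
    unfolding eventually_at_filter by (rule eventually_mono) simp
qed

lemma lower_semicontinuous_continuous:
  fixes h :: "'a::topological_space \<Rightarrow> real"
  assumes "continuous_on UNIV h"
  shows "lower_semicontinuous (\<lambda>x. ereal (h x))"
proof (rule lower_semicontinuousI)
  fix x \<alpha> assume a: "\<alpha> < ereal (h x)"
  have "((\<lambda>z. ereal (h z)) \<longlongrightarrow> ereal (h x)) (nhds x)"
  proof (rule tendsto_ereal)
    have "(h \<longlongrightarrow> h x) (at x)"
      using assms by (auto simp: continuous_on_def)
    then show "(h \<longlongrightarrow> h x) (nhds x)"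
      by (simp add: tendsto_at_iff_tendsto_nhds)
  qed
  then show "eventually (\<lambda>z. \<alpha> < ereal (h z)) (nhds x)"
    using a by (rule order_tendstoD)
qed

lemma lower_semicontinuous_closed_sublevel:
  assumes "lower_semicontinuous F"
  shows "closed {x. F x \<le> c}"
proof -
  have "open {x. c < F x}"
  proof (subst open_subopen, intro ballI)
    fix x assume "x \<in> {x. c < F x}"
    then have "eventually (\<lambda>z. c < F z) (nhds x)"
      using lower_semicontinuous_eventually[OF assms] by simp
    then show "\<exists>T. open T \<and> x \<in> T \<and> T \<subseteq> {x. c < F x}"
      by (auto simp: eventually_nhds)
  qed
  then show ?thesis
    by (simp add: closed_def Collect_neg_eq[symmetric] not_le)
qed

lemma proper_fun_finite:
  assumes "proper_fun F" "x \<in> effective_domain F"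
  shows "F x = ereal (real_of_ereal (F x))"
  using assms unfolding proper_fun_def effective_domain_def
  by (cases "F x") auto

lemma convex_on_real_of_ereal:
  assumes "proper_fun F" "convex_fun F"
  shows "convex_on (effective_domain F) (\<lambda>x. real_of_ereal (F x))"
proof -
  let ?D = "effective_domain F" and ?f = "\<lambda>x. real_of_ereal (F x)"
  have *: "(1 - t) *\<^sub>R x + t *\<^sub>R y \<in> ?D \<and>
      ?f ((1 - t) *\<^sub>R x + t *\<^sub>R y) \<le> (1 - t) * ?f x + t * ?f y"
    if "0 < t" "t < 1" "x \<in> ?D" "y \<in> ?D" for t x y
  proof -
    let ?z = "(1 - t) *\<^sub>R x + t *\<^sub>R y"
    have "F ?z \<le> ereal (1 - t) * F x + ereal t * F y"
      using assms(2) that unfolding convex_fun_def by auto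
    also have "\<dots> = ereal ((1 - t) * ?f x + t * ?f y)"
      by (subst proper_fun_finite[OF assms(1) that(3)], subst proper_fun_finite[OF assms(1) that(4)]) simp
    finally have le: "F ?z \<le> ereal ((1 - t) * ?f x + t * ?f y)" .
    then have "?z \<in> ?D"
      by (auto simp: effective_domain_def intro: order.strict_trans1)
    moreover from le have "?f ?z \<le> (1 - t) * ?f x + t * ?f y"
      by (subst (asm) proper_fun_finite[OF assms(1) \<open>?z \<in> ?D\<close>]) simp
    ultimately show ?thesis ..
  qed
  have "convex ?D"
    unfolding convex_alt
  proof (intro ballI allI impI)
    fix x y t assume "x \<in> ?D" "y \<in> ?D" "0 \<le> t \<and> t \<le> (1::real)"
    then show "(1 - t) *\<^sub>R x + t *\<^sub>R y \<in> ?D"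
      using *[of t x y] by (cases "t = 0"; cases "t = 1") auto
  qed
  then show ?thesis
    using * by (intro convex_onI) auto
qed

lemma convex_fun_ereal:
  assumes "convex_on UNIV h"
  shows "convex_fun (\<lambda>x. ereal (h x))"
  unfolding convex_fun_def using convex_onD[OF assms] by auto

text \<open>
  A proper convex lower semicontinuous function is bounded below near a point \<open>x0\<close> of its domain;
  a value lower than linear growth allows far away would, by convexity along the segment to \<open>x0\<close>,
  violate this local bound. This elementary estimate takes the place of an affine minorant,
  which would require a separation theorem.
\<close>

lemma convex_lower_semicontinuous_linear_growth:
  fixes F :: "'a::real_inner \<Rightarrow> ereal"
  assumes "proper_fun F" "convex_fun F" "lower_semicontinuous F"
  shows "\<exists>m c. \<forall>z\<in>effective_domain F. m - c * norm (z - u) \<le> real_of_ereal (F z)"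
proof -
  let ?D = "effective_domain F"
  define f where "f = (\<lambda>x. real_of_ereal (F x))"
  have fin: "F x = ereal (f x)" if "x \<in> ?D" for x
    using proper_fun_finite[OF assms(1) that] by (simp add: f_def)
  have cvx: "convex_on ?D f"
    unfolding f_def by (rule convex_on_real_of_ereal[OF assms(1,2)])
  obtain x0 where x0: "x0 \<in> ?D"
    using assms(1) by (auto simp: proper_fun_def)
  have "ereal (f x0 - 1) < F x0" using fin[OF x0] by simp
  from lower_semicontinuous_eventually[OF assms(3) this]
  obtain r where r: "r > 0" "\<And>z. dist z x0 < r \<Longrightarrow> ereal (f x0 - 1) < F z"
    by (auto simp: eventually_nhds_metric)
  define c where "c = 2 / r"
  have c: "c > 0" using r(1) by (simp add: c_def)
  have ge: "f z \<ge> f x0 - 1 - c * norm (z - x0)" if z: "z \<in> ?D" for z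
  proof (cases "norm (z - x0) < r")
    case True
    then have "ereal (f x0 - 1) < ereal (f z)"
      using r(2)[of z] fin[OF z] by (simp add: dist_norm)
    then have "f x0 - 1 < f z" by simp
    moreover have "0 \<le> c * norm (z - x0)" using c by simp
    ultimately show ?thesis by linarith
  next
    case False
    define n where "n = norm (z - x0)"
    have n: "n \<ge> r" "n > 0" using False r(1) by (auto simp: n_def)
    define t where "t = r / (2 * n)"
    have t: "0 < t" "t < 1" using n r(1) by (auto simp: t_def field_simps)
    \<comment> \<open>The point of the segment from \<open>x0\<close> to \<open>z\<close> at distance \<open>r / 2\<close> from \<open>x0\<close>.\<close>
    define w where "w = (1 - t) *\<^sub>R x0 + t *\<^sub>R z"
    have "w - x0 = t *\<^sub>R (z - x0)" by (simp add: w_def algebra_simps)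
    then have "norm (w - x0) = r / 2" using t n by (simp add: n_def[symmetric]) (simp add: t_def)
    then have wr: "ereal (f x0 - 1) < F w" using r by (simp add: dist_norm)
    have wD: "w \<in> ?D"
      using convexD_alt[OF convex_on_imp_convex[OF cvx] x0 z, of t] t by (simp add: w_def)
    have "f x0 - 1 < f w" using wr fin[OF wD] by simp
    moreover have "f w \<le> (1 - t) * f x0 + t * f z"
      using convex_onD[OF cvx, of t x0 z] t x0 z by (simp add: w_def)
    ultimately have "t * (f x0 - f z) < 1" by (simp add: algebra_simps)
    then have "f x0 - f z < 1 / t" using t by (simp add: field_simps)
    also have "1 / t = c * n" using n r(1) by (simp add: t_def c_def)
    finally show ?thesis by (simp add: n_def)
  qed
  have "f x0 - 1 - c * norm (u - x0) - c * norm (z - u) \<le> f z" if "z \<in> ?D" for z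
  proof -
    have "norm (z - x0) \<le> norm (z - u) + norm (u - x0)"
      using norm_triangle_ineq[of "z - u" "u - x0"] by simp
    then have "c * norm (z - x0) \<le> c * (norm (z - u) + norm (u - x0))"
      using c by simp
    then show ?thesis using ge[OF that] by (simp add: algebra_simps)
  qed
  then show ?thesis unfolding f_def by blast
qed

section \<open>Proximal points and resolvents\<close>

lemma norm_midpoint_sq:
  fixes a b :: "'a::real_inner"
  shows "(norm ((1/2) *\<^sub>R a + (1/2) *\<^sub>R b))\<^sup>2
    = (norm a)\<^sup>2 / 2 + (norm b)\<^sup>2 / 2 - (norm (a - b))\<^sup>2 / 4"
  unfolding power2_norm_eq_inner by (simp add: inner_simps inner_commute field_simps)

text \<open>
  The quadratic term beats the linear lower growth of \<open>F\<close>, so the infimum is finite. By the midpoint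
  identity a minimizing sequence is Cauchy, and lower semicontinuity passes the value to its limit.
\<close>

lemma proximal_minimizer_exists:
  fixes F :: "'a::{real_inner,complete_space} \<Rightarrow> ereal"
  assumes "proper_fun F" "convex_fun F" "lower_semicontinuous F" "s > 0"
  obtains x where "x \<in> effective_domain F"
    "\<And>z. z \<in> effective_domain F \<Longrightarrow>
      real_of_ereal (F x) + (norm (x - u))\<^sup>2 / (2 * s) \<le> real_of_ereal (F z) + (norm (z - u))\<^sup>2 / (2 * s)"
proof -
  let ?D = "effective_domain F"
  define f where "f = (\<lambda>x. real_of_ereal (F x))"
  have fin: "F x = ereal (f x)" if "x \<in> ?D" for x
    using proper_fun_finite[OF assms(1) that] by (simp add: f_def)
  have cvx: "convex_on ?D f"
    unfolding f_def by (rule convex_on_real_of_ereal[OF assms(1,2)])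
  have Dne: "?D \<noteq> {}" using assms(1) by (auto simp: proper_fun_def)
  define \<phi> where "\<phi> = (\<lambda>z. f z + (norm (z - u))\<^sup>2 / (2 * s))"
  obtain m c where mc: "\<And>z. z \<in> ?D \<Longrightarrow> m - c * norm (z - u) \<le> f z"
    using convex_lower_semicontinuous_linear_growth[OF assms(1-3), of u] by (auto simp: f_def)
  have "m - c\<^sup>2 * s / 2 \<le> \<phi> z" if "z \<in> ?D" for z
  proof -
    have "0 \<le> (norm (z - u) - c * s)\<^sup>2 / (2 * s)" using assms(4) by simp
    also have "\<dots> = (norm (z - u))\<^sup>2 / (2 * s) - c * norm (z - u) + c\<^sup>2 * s / 2"
      using assms(4) by (simp add: power2_eq_square field_simps)
    finally show ?thesis using mc[OF that] by (simp add: \<phi>_def)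
  qed
  then have bdd: "bdd_below (\<phi> ` ?D)" by (auto intro!: bdd_belowI)
  define I where "I = Inf (\<phi> ` ?D)"
  have I_le: "I \<le> \<phi> z" if "z \<in> ?D" for z
    unfolding I_def using bdd that by (intro cInf_lower) auto
  have "\<exists>z\<in>?D. \<phi> z < I + inverse (real (Suc n))" for n
    using cInf_lessD[of "\<phi> ` ?D" "I + inverse (real (Suc n))"] Dne by (auto simp: I_def)
  then obtain X where X: "\<And>n. X n \<in> ?D" "\<And>n. \<phi> (X n) < I + inverse (real (Suc n))"
    by metis
  have mid: "(norm (X i - X j))\<^sup>2 \<le> 4 * s * (inverse (real (Suc i)) + inverse (real (Suc j)))" for i j
  proof -
    let ?w = "(1 - 1/2) *\<^sub>R X i + (1/2) *\<^sub>R X j"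
    have w: "?w \<in> ?D"
      using convexD_alt[OF convex_on_imp_convex[OF cvx] X(1)[of i] X(1)[of j], of "1/2"] by simp
    have fw: "f ?w \<le> f (X i) / 2 + f (X j) / 2"
      using convex_onD[OF cvx, of "1/2" "X i" "X j"] X(1) by simp
    have "?w - u = (1/2) *\<^sub>R (X i - u) + (1/2) *\<^sub>R (X j - u)"
      by (simp add: algebra_simps flip: scaleR_add_left)
    then have nw: "(norm (?w - u))\<^sup>2 = (norm (X i - u))\<^sup>2 / 2 + (norm (X j - u))\<^sup>2 / 2 - (norm (X i - X j))\<^sup>2 / 4"
      by (simp only: norm_midpoint_sq) simp
    have "I \<le> f ?w + (norm (?w - u))\<^sup>2 / (2 * s)" using I_le[OF w] by (simp add: \<phi>_def)
    also have "\<dots> \<le> f (X i) / 2 + f (X j) / 2 + ((norm (X i - u))\<^sup>2 / 2 + (norm (X j - u))\<^sup>2 / 2 - (norm (X i - X j))\<^sup>2 / 4) / (2 * s)"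
      using fw unfolding nw by simp
    also have "\<dots> = (\<phi> (X i) + \<phi> (X j)) / 2 - (norm (X i - X j))\<^sup>2 / (8 * s)"
      using assms(4) by (simp add: \<phi>_def field_simps)
    finally have "I \<le> (\<phi> (X i) + \<phi> (X j)) / 2 - (norm (X i - X j))\<^sup>2 / (8 * s)" .
    moreover have "(\<phi> (X i) + \<phi> (X j)) / 2 \<le> I + (inverse (real (Suc i)) + inverse (real (Suc j))) / 2"
    proof -
      have average: "(a + b) / 2 \<le> I + (p + q) / 2" if "a < I + p" "b < I + q" for a b p q :: real
        using that by (simp add: field_simps)
      show ?thesis by (intro average X(2))
    qed
    ultimately have "(norm (X i - X j))\<^sup>2 / (8 * s) \<le> (inverse (real (Suc i)) + inverse (real (Suc j))) / 2"
      by argo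
    then show ?thesis using assms(4) by (simp add: pos_divide_le_eq mult_ac del: of_nat_Suc)
  qed
  have "Cauchy X"
  proof (rule metric_CauchyI)
    fix e :: real assume e: "e > 0"
    have "0 < e\<^sup>2 / (8 * s)" using e assms(4) by simp
    then obtain N where N: "inverse (real (Suc N)) < e\<^sup>2 / (8 * s)"
      using reals_Archimedean by blast
    show "\<exists>M. \<forall>m\<ge>M. \<forall>n\<ge>M. dist (X m) (X n) < e"
    proof (intro exI allI impI)
      fix i j assume ij: "i \<ge> N" "j \<ge> N"
      have "inverse (real (Suc i)) \<le> inverse (real (Suc N))" "inverse (real (Suc j)) \<le> inverse (real (Suc N))"
        using ij by (auto simp: field_simps)
      then have "inverse (real (Suc i)) + inverse (real (Suc j)) < 2 * (e\<^sup>2 / (8 * s))" using N by linarith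
      then have "4 * s * (inverse (real (Suc i)) + inverse (real (Suc j))) < 4 * s * (2 * (e\<^sup>2 / (8 * s)))"
        using assms(4) by (intro mult_strict_left_mono) auto
      also have "\<dots> = e\<^sup>2" using assms(4) by simp
      finally have "(norm (X i - X j))\<^sup>2 < e\<^sup>2" using mid[of i j] by linarith
      then show "dist (X i) (X j) < e"
        using e by (simp add: dist_norm power2_less_imp_less)
    qed
  qed
  then obtain x where x: "X \<longlonglongrightarrow> x" by (auto simp: Cauchy_convergent_iff convergent_def)
  have Fx: "F x \<le> ereal (I - (norm (x - u))\<^sup>2 / (2 * s))"
  proof (rule dense_le)
    fix \<alpha> assume "\<alpha> < F x"
    from lower_semicontinuous_eventually[OF assms(3) this]
    have ev: "eventually (\<lambda>n. \<alpha> < F (X n)) sequentially"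
      using x by (rule eventually_compose_filterlim)
    have "(\<lambda>n. ereal (I + inverse (real (Suc n)) - (norm (X n - u))\<^sup>2 / (2 * s))) \<longlonglongrightarrow>
        ereal (I + 0 - (norm (x - u))\<^sup>2 / (2 * s))"
      by (intro tendsto_intros x LIMSEQ_inverse_real_of_nat) (use assms(4) in auto)
    moreover have "eventually (\<lambda>n. \<alpha> \<le> ereal (I + inverse (real (Suc n)) - (norm (X n - u))\<^sup>2 / (2 * s))) sequentially"
      using ev
    proof eventually_elim
      case (elim n)
      then have "\<alpha> \<le> ereal (f (X n))" using fin[OF X(1)[of n]] by simp
      also have "\<dots> \<le> ereal (I + inverse (real (Suc n)) - (norm (X n - u))\<^sup>2 / (2 * s))"
        using X(2)[of n] by (simp add: \<phi>_def)
      finally show ?case .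
    qed
    ultimately show "\<alpha> \<le> ereal (I - (norm (x - u))\<^sup>2 / (2 * s))"
      by (intro tendsto_lowerbound[OF _ _ sequentially_bot]) simp_all
  qed
  then have xD: "x \<in> ?D" by (auto simp: effective_domain_def intro: order.strict_trans1)
  then have "f x + (norm (x - u))\<^sup>2 / (2 * s) \<le> I" using Fx fin[OF xD] by simp
  then have "f x + (norm (x - u))\<^sup>2 / (2 * s) \<le> f z + (norm (z - u))\<^sup>2 / (2 * s)" if "z \<in> ?D" for z
    using I_le[OF that] by (simp add: \<phi>_def)
  then show thesis using that[OF xD] unfolding f_def by simp
qed

text \<open>
  Compare the minimizer \<open>x\<close> with \<open>x + t (z - x)\<close>, divide by \<open>t\<close> and let \<open>t\<close> tend to zero.
\<close>

lemma proximal_minimizer_subgradient: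
  fixes F :: "'a::real_inner \<Rightarrow> ereal"
  assumes "proper_fun F" "convex_fun F" "s > 0" and x: "x \<in> effective_domain F"
    and min: "\<And>z. z \<in> effective_domain F \<Longrightarrow>
      real_of_ereal (F x) + (norm (x - u))\<^sup>2 / (2 * s) \<le> real_of_ereal (F z) + (norm (z - u))\<^sup>2 / (2 * s)"
  shows "(1 / s) *\<^sub>R (u - x) \<in> subdifferential F x"
  unfolding subdifferential_def
proof (intro CollectI allI)
  fix z
  let ?D = "effective_domain F"
  define f where "f = (\<lambda>x. real_of_ereal (F x))"
  have fin: "F x = ereal (f x)" if "x \<in> ?D" for x
    using proper_fun_finite[OF assms(1) that] by (simp add: f_def)
  have cvx: "convex_on ?D f"
    unfolding f_def by (rule convex_on_real_of_ereal[OF assms(1,2)])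
  show "F x + ereal (inner ((1 / s) *\<^sub>R (u - x)) (z - x)) \<le> F z"
  proof (cases "z \<in> ?D")
    case False
    then show ?thesis by (simp add: effective_domain_def)
  next
    case z: True
    have *: "f x + inner (u - x) (z - x) / s \<le> f z + t * ((norm (z - x))\<^sup>2 / (2 * s))" if t: "0 < t" "t < 1" for t
    proof -
      let ?w = "(1 - t) *\<^sub>R x + t *\<^sub>R z"
      have w: "?w \<in> ?D"
        using convexD_alt[OF convex_on_imp_convex[OF cvx] x z, of t] t by simp
      have fw: "f ?w \<le> (1 - t) * f x + t * f z"
        using convex_onD[OF cvx, of t x z] t x z by simp
      have "?w - u = (x - u) + t *\<^sub>R (z - x)" by (simp add: algebra_simps)
      then have nw: "(norm (?w - u))\<^sup>2 = (norm (x - u))\<^sup>2 + 2 * t * inner (x - u) (z - x) + t\<^sup>2 * (norm (z - x))\<^sup>2"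
        unfolding power2_norm_eq_inner by (simp add: inner_simps inner_commute power2_eq_square algebra_simps)
      have "f x + (norm (x - u))\<^sup>2 / (2 * s) \<le> f ?w + (norm (?w - u))\<^sup>2 / (2 * s)"
        using min[OF w] by (simp add: f_def)
      also have "\<dots> \<le> (1 - t) * f x + t * f z + (norm (?w - u))\<^sup>2 / (2 * s)" using fw by simp
      also have "\<dots> = f x + (norm (x - u))\<^sup>2 / (2 * s)
          + t * (f z - f x + inner (x - u) (z - x) / s + t * ((norm (z - x))\<^sup>2 / (2 * s)))"
        using assms(3) unfolding nw by (simp add: field_simps power2_eq_square)
      finally have "0 \<le> t * (f z - f x + inner (x - u) (z - x) / s + t * ((norm (z - x))\<^sup>2 / (2 * s)))"
        by simp
      then have "0 \<le> f z - f x + inner (x - u) (z - x) / s + t * ((norm (z - x))\<^sup>2 / (2 * s))"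
        using t by (simp add: zero_le_mult_iff)
      moreover have "inner (x - u) (z - x) = - inner (u - x) (z - x)" by (simp add: inner_simps)
      ultimately show ?thesis by simp
    qed
    have "((\<lambda>t. f z + t * ((norm (z - x))\<^sup>2 / (2 * s))) \<longlongrightarrow> f z + 0 * ((norm (z - x))\<^sup>2 / (2 * s))) (at_right 0)"
      by (intro tendsto_intros)
    moreover have "eventually (\<lambda>t. f x + inner (u - x) (z - x) / s \<le> f z + t * ((norm (z - x))\<^sup>2 / (2 * s))) (at_right (0::real))"
      using eventually_at_right_real[of 0 1, OF zero_less_one] by (rule eventually_mono) (rule *, auto)
    ultimately have "f x + inner (u - x) (z - x) / s \<le> f z + 0 * ((norm (z - x))\<^sup>2 / (2 * s))"
      by (intro tendsto_lowerbound) auto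
    then show ?thesis using fin[OF x] fin[OF z] by simp
  qed
qed

lemma subdifferential_real:
  assumes "proper_fun F" "p \<in> subdifferential F x"
  shows "x \<in> effective_domain F"
    and "z \<in> effective_domain F \<Longrightarrow> real_of_ereal (F x) + inner p (z - x) \<le> real_of_ereal (F z)"
proof -
  obtain w where w: "w \<in> effective_domain F" using assms(1) by (auto simp: proper_fun_def)
  have sub: "F x + ereal (inner p (z - x)) \<le> F z" for z
    using assms(2) by (simp add: subdifferential_def)
  show x: "x \<in> effective_domain F"
    using sub[of w] w by (cases "F x") (auto simp: effective_domain_def)
  show "real_of_ereal (F x) + inner p (z - x) \<le> real_of_ereal (F z)" if "z \<in> effective_domain F"
    using sub[of z]
    by (subst (asm) proper_fun_finite[OF assms(1) x], subst (asm) proper_fun_finite[OF assms(1) that]) simp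
qed

text \<open>
  The resolvent is a definite description; the minimizer supplies existence and the monotonicity of
  the subdifferential supplies uniqueness.
\<close>

lemma resolvent_subgradient:
  fixes F :: "'a::{real_inner,complete_space} \<Rightarrow> ereal"
  assumes "proper_fun F" "convex_fun F" "lower_semicontinuous F" "s > 0"
  shows "(1 / s) *\<^sub>R (u - resolvent s (subdifferential F) u)
    \<in> subdifferential F (resolvent s (subdifferential F) u)"
proof -
  let ?P = "\<lambda>x. \<exists>p\<in>subdifferential F x. u = x + s *\<^sub>R p"
  have iff: "?P x \<longleftrightarrow> (1 / s) *\<^sub>R (u - x) \<in> subdifferential F x" for x
  proof
    assume "(1 / s) *\<^sub>R (u - x) \<in> subdifferential F x"
    then show "?P x" by (rule bexI[rotated]) (use assms(4) in simp)
  qed (use assms(4) in auto)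
  obtain x where x: "(1 / s) *\<^sub>R (u - x) \<in> subdifferential F x"
  proof -
    obtain x where "x \<in> effective_domain F"
      "\<And>z. z \<in> effective_domain F \<Longrightarrow>
        real_of_ereal (F x) + (norm (x - u))\<^sup>2 / (2 * s) \<le> real_of_ereal (F z) + (norm (z - u))\<^sup>2 / (2 * s)"
      by (rule proximal_minimizer_exists[OF assms, where u = u]) (rule that)
    from that[OF proximal_minimizer_subgradient[OF assms(1,2,4) this]] show thesis .
  qed
  have "?P (THE x. ?P x)"
  proof (rule theI[of ?P])
    show "?P x" using x iff by simp
    fix z assume "?P z"
    then have z: "(1 / s) *\<^sub>R (u - z) \<in> subdifferential F z" using iff by simp
    \<comment> \<open>The sum of the two subgradient inequalities bounds \<open>norm (z - x) ^ 2 / s\<close> by \<open>0\<close>.\<close>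
    have "inner ((1 / s) *\<^sub>R (u - x)) (z - x) + inner ((1 / s) *\<^sub>R (u - z)) (x - z) \<le> 0"
      using subdifferential_real(2)[OF assms(1) x subdifferential_real(1)[OF assms(1) z]]
        subdifferential_real(2)[OF assms(1) z subdifferential_real(1)[OF assms(1) x]] by linarith
    then have "(1 / s) * (inner (u - x) (z - x) + inner (u - z) (x - z)) \<le> 0"
      by (simp only: inner_scaleR_left distrib_left)
    then have "inner (u - x) (z - x) + inner (u - z) (x - z) \<le> 0"
      using assms(4) by (simp add: divide_le_0_iff)
    then have "inner (z - x) (z - x) \<le> 0" by (simp add: inner_simps inner_commute)
    then show "z = x" by (metis inner_ge_zero inner_eq_zero_iff order_antisym right_minus_eq)
  qed
  then show ?thesis using iff by (simp add: resolvent_def)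
qed

section \<open>Riesz representation, adjoints and the linear solve\<close>

lemma linear_le_quadratic_imp_zero:
  fixes a b :: real
  assumes "\<And>t. t * a \<le> t\<^sup>2 * b"
  shows "a = 0"
proof (rule ccontr)
  assume a: "a \<noteq> 0"
  define c where "c = \<bar>b\<bar> + 1"
  have c: "c > 0" "b < c" by (auto simp: c_def)
  have "(a / c) * a \<le> (a / c)\<^sup>2 * b" by (rule assms)
  also have "\<dots> < (a / c)\<^sup>2 * c" using a c by (intro mult_strict_left_mono) auto
  also have "\<dots> = (a / c) * a" using c by (simp add: power2_eq_square)
  finally show False by simp
qed

text \<open>
  The representing vector is the proximal point of \<open>- f\<close> at the origin: a subgradient of a linear
  functional can only be the functional itself.
\<close>

lemma riesz_representation:
  fixes f :: "'a::{real_inner,complete_space} \<Rightarrow> real"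
  assumes "bounded_linear f"
  shows "\<exists>r. \<forall>x. f x = inner r x"
proof -
  interpret f: bounded_linear f by fact
  let ?H = "\<lambda>x. ereal (- f x)"
  have H: "proper_fun ?H" "convex_fun ?H" "lower_semicontinuous ?H" "effective_domain ?H = UNIV"
    by (auto simp: proper_fun_def effective_domain_def f.add f.scaleR
        intro!: convex_fun_ereal convex_onI lower_semicontinuous_continuous continuous_intros f.continuous_on)
  define r where "r = resolvent 1 (subdifferential ?H) 0"
  have "- r \<in> subdifferential ?H r"
    using resolvent_subgradient[OF H(1-3), of 1 0] by (simp add: r_def)
  then have sub: "f w \<le> inner r w" for w
    using subdifferential_real(2)[OF H(1), of "- r" r "r + w"] H(4) by (simp add: f.add)
  have "f x = inner r x" for x
    using sub[of x] sub[of "- x"] by (simp add: f.neg)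
  then show ?thesis by blast
qed

text \<open>
  The adjoint is defined by a choice operator; Riesz representation shows that there is something to
  choose when the domain is a Hilbert space.
\<close>

lemma adjoint_inner:
  fixes K :: "'a::{real_inner,complete_space} \<Rightarrow> 'b::real_inner"
  assumes "bounded_linear K"
  shows "inner (K x) y = inner x (adjoint K y)"
proof -
  have "\<exists>r. \<forall>x. inner (K x) y = inner x r" for y
    using riesz_representation[OF bounded_linear_inner_left_comp[OF assms, of y]]
    by (auto simp: inner_commute)
  then have "\<exists>g. \<forall>y x. inner (K x) y = inner x (g y)" by (intro choice allI)
  then obtain g where g: "\<forall>x y. inner (K x) y = inner x (g y)" by auto
  show ?thesis using g adjoint_unique[OF g] by simp
qed

lemma bounded_linear_adjoint:
  fixes K :: "'a::{real_inner,complete_space} \<Rightarrow> 'b::real_inner"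
  assumes "bounded_linear K"
  shows "bounded_linear (adjoint K)"
proof -
  note adj = adjoint_inner[OF assms, symmetric]
  obtain c where c: "\<And>x. norm (K x) \<le> norm x * c" "c > 0"
    using bounded_linear.pos_bounded[OF assms] by blast
  show ?thesis
  proof (rule bounded_linear_intro[where K = c])
    show "adjoint K (y + z) = adjoint K y + adjoint K z" for y z
      by (subst vector_eq_rdot[symmetric]) (simp add: inner_simps inner_commute[of _ "_::'a"] adj)
    show "adjoint K (r *\<^sub>R y) = r *\<^sub>R adjoint K y" for r y
      by (subst vector_eq_rdot[symmetric]) (simp add: inner_simps inner_commute[of _ "_::'a"] adj)
    show "norm (adjoint K y) \<le> norm y * c" for y
    proof -
      have "norm (adjoint K y) * norm (adjoint K y) = inner (K (adjoint K y)) y"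
        by (simp add: adjoint_inner[OF assms] power2_norm_eq_inner flip: power2_eq_square)
      also have "\<dots> \<le> norm (K (adjoint K y)) * norm y" by (rule norm_cauchy_schwarz)
      also have "\<dots> \<le> norm (adjoint K y) * c * norm y"
        by (intro mult_right_mono c) auto
      finally have "norm (adjoint K y) * norm (adjoint K y) \<le> norm (adjoint K y) * (norm y * c)"
        by (simp add: mult_ac)
      then show ?thesis using c(2)
        by (cases "norm (adjoint K y) = 0") (auto dest: mult_left_le_imp_le)
    qed
  qed
qed

text \<open>
  A solution of \<open>u + c K\<^sup>* K u = b\<close> is the proximal point at \<open>b\<close> of \<open>u \<mapsto> c / 2 * \<parallel>K u\<parallel>\<^sup>2\<close>. Surjectivity
  is what makes the inverse in the iteration solve this equation.
\<close>

lemma surj_id_plus_adjoint_comp: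
  fixes K :: "'a::{real_inner,complete_space} \<Rightarrow> 'b::real_inner"
  assumes "bounded_linear K" "c > 0"
  shows "surj (\<lambda>u. u + c *\<^sub>R adjoint K (K u))"
proof (rule surjI)
  interpret K: bounded_linear K by fact
  let ?H = "\<lambda>x. ereal (c / 2 * (norm (K x))\<^sup>2)"
  fix b
  have quad: "(norm (u + t *\<^sub>R w))\<^sup>2 = (norm u)\<^sup>2 + 2 * t * inner u w + t\<^sup>2 * (norm w)\<^sup>2" for u w :: 'b and t
    unfolding power2_norm_eq_inner by (simp add: inner_simps inner_commute power2_eq_square algebra_simps)
  have "convex_on UNIV (\<lambda>x. c / 2 * (norm (K x))\<^sup>2)"
  proof (rule convex_onI)
    fix t :: real and x y assume t: "0 < t" "t < 1"
    have "(1 - t) * (norm (K x))\<^sup>2 + t * (norm (K y))\<^sup>2 - (norm (K ((1 - t) *\<^sub>R x + t *\<^sub>R y)))\<^sup>2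
        = t * (1 - t) * (norm (K x - K y))\<^sup>2"
      unfolding power2_norm_eq_inner K.add K.scaleR
      by (simp add: inner_simps inner_commute power2_eq_square algebra_simps)
    also have "\<dots> \<ge> 0" using t by simp
    finally have "(norm (K ((1 - t) *\<^sub>R x + t *\<^sub>R y)))\<^sup>2 \<le> (1 - t) * (norm (K x))\<^sup>2 + t * (norm (K y))\<^sup>2"
      by simp
    then have "c / 2 * (norm (K ((1 - t) *\<^sub>R x + t *\<^sub>R y)))\<^sup>2
        \<le> c / 2 * ((1 - t) * (norm (K x))\<^sup>2 + t * (norm (K y))\<^sup>2)"
      using assms(2) by (intro mult_left_mono) auto
    then show "c / 2 * (norm (K ((1 - t) *\<^sub>R x + t *\<^sub>R y)))\<^sup>2
        \<le> (1 - t) * (c / 2 * (norm (K x))\<^sup>2) + t * (c / 2 * (norm (K y))\<^sup>2)"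
      by (simp only: distrib_left mult.left_commute)
  qed simp
  then have H: "proper_fun ?H" "convex_fun ?H" "lower_semicontinuous ?H" "effective_domain ?H = UNIV"
    by (auto simp: proper_fun_def effective_domain_def
        intro!: convex_fun_ereal lower_semicontinuous_continuous continuous_intros K.continuous_on)
  define u where "u = resolvent 1 (subdifferential ?H) b"
  have sub: "b - u \<in> subdifferential ?H u"
    using resolvent_subgradient[OF H(1-3), of 1 b] by (simp add: u_def)
  have "inner (b - u) w = inner (c *\<^sub>R adjoint K (K u)) w" for w
  proof -
    have "inner (b - u) w - c * inner (K u) (K w) = 0"
    proof (rule linear_le_quadratic_imp_zero)
      fix t
      have "t * inner (b - u) w + c / 2 * (norm (K u))\<^sup>2 \<le> c / 2 * (norm (K u + t *\<^sub>R K w))\<^sup>2"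
        using subdifferential_real(2)[OF H(1) sub, of "u + t *\<^sub>R w"] H(4)
        by (simp add: K.add K.scaleR)
      then show "t * (inner (b - u) w - c * inner (K u) (K w)) \<le> t\<^sup>2 * (c / 2 * (norm (K w))\<^sup>2)"
        unfolding quad by (simp add: algebra_simps)
    qed
    then show ?thesis
      using adjoint_inner[OF assms(1), of w "K u"] by (simp add: inner_commute)
  qed
  then have "b - u = c *\<^sub>R adjoint K (K u)" using vector_eq_rdot by blast
  then show "u + c *\<^sub>R adjoint K (K u) = b" by (simp add: algebra_simps)
qed

section \<open>Weak topology of a Hilbert space\<close>

text \<open>
  The projection \<open>z\<close> of the weak limit \<open>l\<close> onto \<open>C\<close>, a proximal point of the indicator function of
  \<open>C\<close>, satisfies \<open>\<langle>l - z, w - z\<rangle> \<le> 0\<close> for all \<open>w \<in> C\<close>. This inequality survives the weak limit, and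
  for \<open>w = l\<close> it says \<open>l = z\<close>.
\<close>

lemma closed_convex_weakly_closed:
  fixes C :: "'a::{real_inner,complete_space} set"
  assumes "closed C" "convex C" "\<Phi> \<noteq> bot" "eventually (\<lambda>n. w n \<in> C) \<Phi>"
    and lim: "\<And>v. ((\<lambda>n. inner (w n) v) \<longlongrightarrow> inner l v) \<Phi>"
  shows "l \<in> C"
proof -
  let ?H = "\<lambda>x. if x \<in> C then 0 else \<infinity> :: ereal"
  have dom: "effective_domain ?H = C" by (auto simp: effective_domain_def)
  have "C \<noteq> {}" using assms(3,4) by auto
  then have pr: "proper_fun ?H" by (auto simp: proper_fun_def dom)
  have cv: "convex_fun ?H"
    using assms(2) by (auto simp: convex_fun_def convex_alt)
  have lsc: "lower_semicontinuous ?H"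
  proof (rule lower_semicontinuousI)
    fix x \<alpha> assume a: "\<alpha> < ?H x"
    show "eventually (\<lambda>z. \<alpha> < ?H z) (nhds x)"
    proof (cases "x \<in> C")
      case True
      then show ?thesis using a by (auto intro!: always_eventually)
    next
      case False
      then have "eventually (\<lambda>z. z \<in> - C) (nhds x)"
        using assms(1) by (intro eventually_nhds_in_open) auto
      then show ?thesis by (rule eventually_mono) (use a False in auto)
    qed
  qed
  define z where "z = resolvent 1 (subdifferential ?H) l"
  have sub: "l - z \<in> subdifferential ?H z"
    using resolvent_subgradient[OF pr cv lsc, of 1 l] by (simp add: z_def)
  have zC: "z \<in> C" using subdifferential_real(1)[OF pr sub] by (simp add: dom)
  have "inner x (l - z) \<le> inner z (l - z)" if "x \<in> C" for x
  proof -
    have "inner (l - z) (x - z) \<le> 0"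
      using subdifferential_real(2)[OF pr sub, of x] that zC by (simp add: dom)
    moreover have "inner (l - z) (x - z) = inner x (l - z) - inner z (l - z)"
      by (simp add: inner_diff_left inner_diff_right inner_commute)
    ultimately show ?thesis by simp
  qed
  with assms(4) have "eventually (\<lambda>n. inner (w n) (l - z) \<le> inner z (l - z)) \<Phi>"
    by (auto elim: eventually_mono)
  with lim[of "l - z"] assms(3) have "inner l (l - z) \<le> inner z (l - z)"
    by (intro tendsto_upperbound)
  then have "inner (l - z) (l - z) \<le> 0" by (simp add: inner_simps)
  then have "l = z" by (metis inner_ge_zero inner_eq_zero_iff order_antisym right_minus_eq)
  with zC show ?thesis by simp
qed

text \<open>
  Weak compactness of balls, for filters. The functionals \<open>v \<mapsto> \<langle>w n, v\<rangle>\<close> lie in a product of compact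
  intervals, which is compact by Tychonoff's theorem. A pointwise cluster point of them is again linear
  and bounded, hence of the form \<open>v \<mapsto> \<langle>l, v\<rangle>\<close>.
\<close>

lemma bounded_weak_cluster_point:
  fixes w :: "'i \<Rightarrow> 'a::{real_inner,complete_space}"
  assumes "\<Phi> \<noteq> bot" and bound: "\<And>n. norm (w n) \<le> R"
  obtains \<Psi> l where "\<Psi> \<le> \<Phi>" "\<Psi> \<noteq> bot" "\<And>v. ((\<lambda>n. inner (w n) v) \<longlongrightarrow> inner l v) \<Psi>"
proof -
  define W where "W = (\<lambda>n v. inner (w n) v)"
  define P where "P = Pi\<^sub>E UNIV (\<lambda>v::'a. {- (R * norm v)..R * norm v})"
  have "compactin (product_topology (\<lambda>v::'a. euclideanreal) UNIV) P"
    unfolding P_def by (subst compactin_PiE) (auto simp: compactin_euclidean_iff)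
  then have "compact P"
    by (simp add: euclidean_product_topology compactin_euclidean_iff)
  have "W n \<in> P" for n
  proof -
    have "\<bar>inner (w n) v\<bar> \<le> R * norm v" for v
      by (rule order_trans[OF Cauchy_Schwarz_ineq2]) (intro mult_right_mono bound norm_ge_zero)
    then show ?thesis by (auto simp: P_def W_def abs_le_iff minus_le_iff)
  qed
  obtain f where f: "f \<in> P" "inf (nhds f) (filtermap W \<Phi>) \<noteq> bot"
  proof -
    have "filtermap W \<Phi> \<noteq> bot" "eventually (\<lambda>g. g \<in> P) (filtermap W \<Phi>)"
      using assms(1) \<open>\<And>n. W n \<in> P\<close> by (auto simp: filtermap_bot_iff eventually_filtermap)
    then show thesis
      using \<open>compact P\<close>[unfolded compact_filter, rule_format, of "filtermap W \<Phi>"] that by auto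
  qed
  define \<Psi> where "\<Psi> = inf (filtercomap W (nhds f)) \<Phi>"
  have "\<Psi> \<le> \<Phi>" by (simp add: \<Psi>_def)
  have nb: "\<Psi> \<noteq> bot"
  proof
    assume "\<Psi> = bot"
    then obtain A B where AB: "eventually A (filtercomap W (nhds f))" "eventually B \<Phi>" "\<And>x. A x \<Longrightarrow> B x \<Longrightarrow> False"
      unfolding \<Psi>_def trivial_limit_def eventually_inf by auto
    then obtain Q where Q: "eventually Q (nhds f)" "\<And>x. Q (W x) \<Longrightarrow> A x"
      by (auto simp: eventually_filtercomap)
    have "eventually (\<lambda>g. \<not> Q g) (filtermap W \<Phi>)"
      unfolding eventually_filtermap using AB(2) by (rule eventually_mono) (use AB(3) Q(2) in blast)
    with Q(1) have "inf (nhds f) (filtermap W \<Phi>) = bot"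
      unfolding trivial_limit_def eventually_inf
      by (intro exI[of _ Q] exI[of _ "\<lambda>g. \<not> Q g"]) simp
    with f(2) show False by simp
  qed
  have "filterlim W (nhds f) \<Psi>"
    unfolding \<Psi>_def by (rule filterlim_mono[OF filterlim_filtercomap]) auto
  then have lim: "((\<lambda>n. inner (w n) v) \<longlongrightarrow> f v) \<Psi>" for v
    using continuous_on_tendsto_compose[OF continuous_on_product_coordinates[of v], of W f \<Psi>]
    by (simp add: W_def)
  have "bounded_linear f"
  proof (rule bounded_linear_intro[where K = R])
    fix x y
    show "f (x + y) = f x + f y"
      using tendsto_unique[OF nb lim[of "x + y"]] tendsto_add[OF lim[of x] lim[of y]]
      by (simp add: inner_simps)
  next
    fix r x
    show "f (r *\<^sub>R x) = r *\<^sub>R f x"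
      using tendsto_unique[OF nb lim[of "r *\<^sub>R x"]] tendsto_mult_left[OF lim[of x], of r]
      by (simp add: inner_simps)
  next
    fix x
    have "f x \<in> {- (R * norm x)..R * norm x}" using f(1) unfolding P_def by auto
    then show "norm (f x) \<le> norm x * R" by (auto simp: abs_le_iff mult.commute)
  qed
  then obtain l where "\<And>v. f v = inner l v" using riesz_representation by blast
  with lim have "\<And>v. ((\<lambda>n. inner (w n) v) \<longlongrightarrow> inner l v) \<Psi>" by simp
  with \<open>\<Psi> \<le> \<Phi>\<close> nb show thesis by (rule that)
qed

text \<open>
  If some functional stayed away from its limit infinitely often, the filter generated by those
  indices would have a cluster point of its own, which by uniqueness is the same one.
\<close>

lemma weak_convergence_if_unique_cluster_point:
  fixes w :: "nat \<Rightarrow> 'a::{real_inner,complete_space}"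
  assumes bound: "\<And>n. norm (w n) \<le> R"
    and uniq: "\<And>\<Psi> l \<Psi>' l'. \<lbrakk>\<Psi> \<le> sequentially; \<Psi> \<noteq> bot; \<And>v. ((\<lambda>n. inner (w n) v) \<longlongrightarrow> inner l v) \<Psi>;
      \<Psi>' \<le> sequentially; \<Psi>' \<noteq> bot; \<And>v. ((\<lambda>n. inner (w n) v) \<longlongrightarrow> inner l' v) \<Psi>'\<rbrakk> \<Longrightarrow> l = l'"
  obtains l \<Psi> where "\<Psi> \<le> sequentially" "\<Psi> \<noteq> bot" "\<And>v. ((\<lambda>n. inner (w n) v) \<longlongrightarrow> inner l v) \<Psi>"
    "weakly_converges_to w l"
proof -
  obtain \<Psi> l where \<Psi>: "\<Psi> \<le> sequentially" "\<Psi> \<noteq> bot" "\<And>v. ((\<lambda>n. inner (w n) v) \<longlongrightarrow> inner l v) \<Psi>"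
    by (rule bounded_weak_cluster_point[OF sequentially_bot, of w R]) (use bound in auto)
  have "(\<lambda>n. inner (w n) v) \<longlonglongrightarrow> inner l v" for v
  proof (rule ccontr)
    assume "\<not> (\<lambda>n. inner (w n) v) \<longlonglongrightarrow> inner l v"
    then obtain e where e: "e > 0" "\<not> eventually (\<lambda>n. dist (inner (w n) v) (inner l v) < e) sequentially"
      by (auto simp: tendsto_iff)
    define A where "A = {n. \<not> dist (inner (w n) v) (inner l v) < e}"
    have "inf sequentially (principal A) \<noteq> bot"
      using e(2) by (auto simp: trivial_limit_def eventually_inf_principal A_def)
    then obtain \<Psi>' l' where \<Psi>': "\<Psi>' \<le> inf sequentially (principal A)" "\<Psi>' \<noteq> bot"
        "\<And>v. ((\<lambda>n. inner (w n) v) \<longlongrightarrow> inner l' v) \<Psi>'"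
      by (rule bounded_weak_cluster_point[of _ w R]) (use bound in auto)
    have "l = l'" using \<Psi> \<Psi>' by (intro uniq[of \<Psi> l \<Psi>' l']) auto
    then have "eventually (\<lambda>n. dist (inner (w n) v) (inner l v) < e) \<Psi>'"
      using \<Psi>'(3) e(1) by (simp add: tendsto_iff)
    moreover have "eventually (\<lambda>n. n \<in> A) \<Psi>'"
      using \<Psi>'(1) by (auto simp: le_filter_def eventually_inf_principal)
    ultimately have "eventually (\<lambda>n. False) \<Psi>'"
      by eventually_elim (simp add: A_def)
    with \<Psi>'(2) show False by (simp add: trivial_limit_def)
  qed
  then have "(\<lambda>n. f (w n)) \<longlonglongrightarrow> f l" if "bounded_linear f" for f :: "'a \<Rightarrow> real"
    using riesz_representation[OF that] by (auto simp: inner_commute)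
  then have "weakly_converges_to w l"
    unfolding weakly_converges_to_def by simp
  with \<Psi> show thesis by (rule that)
qed

text \<open>
  Otherwise \<open>w n\<close> lies frequently in a sublevel set, which is closed and convex and so would contain
  the weak limit.
\<close>

lemma convex_weakly_lower_semicontinuous:
  fixes F :: "'a::{real_inner,complete_space} \<Rightarrow> ereal"
  assumes "convex_fun F" "lower_semicontinuous F"
    and lim: "\<And>v. ((\<lambda>n. inner (w n) v) \<longlongrightarrow> inner l v) \<Phi>"
    and less: "ereal \<alpha> < F l"
  shows "eventually (\<lambda>n. ereal \<alpha> < F (w n)) \<Phi>"
proof (rule ccontr)
  assume not_ev: "\<not> eventually (\<lambda>n. ereal \<alpha> < F (w n)) \<Phi>"
  let ?C = "{x. F x \<le> ereal \<alpha>}"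
  define \<Psi> where "\<Psi> = inf \<Phi> (principal {n. w n \<in> ?C})"
  have "\<Psi> \<noteq> bot"
    using not_ev by (auto simp: \<Psi>_def trivial_limit_def eventually_inf_principal not_le)
  moreover have "convex ?C"
    unfolding convex_alt
  proof (intro ballI allI impI)
    fix x y t assume xy: "x \<in> ?C" "y \<in> ?C" and t: "0 \<le> t \<and> t \<le> (1::real)"
    show "(1 - t) *\<^sub>R x + t *\<^sub>R y \<in> ?C"
    proof (cases "t = 0 \<or> t = 1")
      case False
      then have t: "0 < t" "t < 1" using t by auto
      then have "F ((1 - t) *\<^sub>R x + t *\<^sub>R y) \<le> ereal (1 - t) * F x + ereal t * F y"
        using assms(1) by (simp add: convex_fun_def)
      also have "\<dots> \<le> ereal (1 - t) * ereal \<alpha> + ereal t * ereal \<alpha>"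
        using xy t by (intro add_mono ereal_mult_left_mono) auto
      also have "\<dots> = ereal \<alpha>" by (simp add: algebra_simps)
      finally show ?thesis by simp
    qed (use xy in auto)
  qed
  moreover have "closed ?C" by (rule lower_semicontinuous_closed_sublevel) fact
  moreover have "eventually (\<lambda>n. w n \<in> ?C) \<Psi>"
    by (simp add: \<Psi>_def eventually_inf_principal)
  moreover have "((\<lambda>n. inner (w n) v) \<longlongrightarrow> inner l v) \<Psi>" for v
    using lim by (rule tendsto_mono[rotated]) (simp add: \<Psi>_def)
  ultimately have "l \<in> ?C" by (intro closed_convex_weakly_closed)
  with less show False by simp
qed

section \<open>Ergodic means\<close>

lemma cesaro_mean_tendsto:
  fixes a :: "nat \<Rightarrow> real"
  assumes "a \<longlonglongrightarrow> l"
  shows "(\<lambda>k. (\<Sum>j = 1..k. a j) / real k) \<longlonglongrightarrow> l"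
proof (rule LIMSEQ_I)
  fix e :: real assume e: "e > 0"
  then obtain N where N: "\<And>n. n \<ge> N \<Longrightarrow> \<bar>a n - l\<bar> < e / 2"
    using LIMSEQ_D[OF assms, of "e / 2"] by auto
  define C where "C = (\<Sum>j = 1..N. \<bar>a j - l\<bar>)"
  obtain M where M: "2 * C / e < real M" using reals_Archimedean2 by blast
  have "\<bar>(\<Sum>j = 1..k. a j) / real k - l\<bar> < e" if k: "k \<ge> max N M + 1" for k
  proof -
    have "(\<Sum>j = 1..k. a j) / real k - l = (\<Sum>j = 1..k. a j - l) / real k"
      using k by (simp add: sum_subtractf field_simps)
    also have "\<bar>\<dots>\<bar> \<le> (\<Sum>j = 1..k. \<bar>a j - l\<bar>) / real k"
      by (simp add: divide_right_mono)
    also have "(\<Sum>j = 1..k. \<bar>a j - l\<bar>) = C + (\<Sum>j = N+1..k. \<bar>a j - l\<bar>)"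
      unfolding C_def using k sum.ub_add_nat[of 1 N "\<lambda>j. \<bar>a j - l\<bar>" "k - N"] by simp
    also have "\<dots> \<le> C + (\<Sum>j = N+1..k. e / 2)"
      by (intro add_left_mono sum_mono less_imp_le N) auto
    also have "\<dots> \<le> C + real k * (e / 2)" using e by (simp add: mult_right_mono)
    finally have "\<bar>(\<Sum>j = 1..k. a j) / real k - l\<bar> \<le> (C + real k * (e / 2)) / real k"
      by (simp add: divide_right_mono)
    moreover have "C < real k * (e / 2)"
    proof -
      have "2 * C / e < real k" using M k by linarith
      then show ?thesis using e by (simp add: field_simps)
    qed
    then have "(C + real k * (e / 2)) / real k < e" using k by (simp add: field_simps)
    ultimately show ?thesis by linarith
  qed
  then show "\<exists>no. \<forall>n\<ge>no. norm ((\<Sum>j = 1..n. a j) / real n - l) < e" by auto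
qed

lemma weakly_converges_to_ergodic_mean:
  assumes "weakly_converges_to u l"
  shows "weakly_converges_to (ergodic_mean u) l"
  unfolding weakly_converges_to_def
proof (intro allI impI)
  fix f :: "'a \<Rightarrow> real" assume f: "bounded_linear f"
  interpret f: bounded_linear f by fact
  have "f (ergodic_mean u k) = (\<Sum>j = 1..k. f (u j)) / real k" for k
    by (simp add: ergodic_mean_def f.scaleR f.sum)
  moreover have "(\<lambda>n. f (u n)) \<longlonglongrightarrow> f l"
    using assms f by (simp add: weakly_converges_to_def)
  ultimately show "(\<lambda>k. f (ergodic_mean u k)) \<longlonglongrightarrow> f l"
    using cesaro_mean_tendsto by simp
qed

section \<open>The Douglas-Rachford iteration in implicit form\<close>

lemma tendsto_inner_null_bounded:
  fixes u z :: "'i \<Rightarrow> 'a::real_inner"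
  assumes "(u \<longlongrightarrow> 0) \<Phi>" "\<And>n. norm (z n) \<le> R"
  shows "((\<lambda>n. inner (u n) (z n)) \<longlongrightarrow> 0) \<Phi>"
proof (rule Lim_null_comparison)
  show "eventually (\<lambda>n. norm (inner (u n) (z n)) \<le> norm (u n) * R) \<Phi>"
    using assms(2) by (auto intro!: always_eventually order_trans[OF Cauchy_Schwarz_ineq2] mult_left_mono)
  show "((\<lambda>n. norm (u n) * R) \<longlongrightarrow> 0) \<Phi>"
    using tendsto_mult_right[OF tendsto_norm_zero[OF assms(1)], of R] by simp
qed

locale douglas_rachford =
  fixes K :: "'a::{real_inner, complete_space} \<Rightarrow> 'b::{real_inner, complete_space}"
    and F :: "'a \<Rightarrow> ereal" and G :: "'b \<Rightarrow> ereal"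
    and \<sigma> \<tau> :: real
    and x xbar b d :: "nat \<Rightarrow> 'a" and y ybar :: "nat \<Rightarrow> 'b"
  assumes K: "bounded_linear K"
    and F: "proper_fun F" "convex_fun F" "lower_semicontinuous F"
    and G: "proper_fun G" "convex_fun G" "lower_semicontinuous G"
    and pos: "\<sigma> > 0" "\<tau> > 0"
    and x_step: "\<And>k. x (Suc k) = resolvent \<sigma> (subdifferential F) (xbar k)"
    and y_step: "\<And>k. y (Suc k) = resolvent \<tau> (subdifferential G) (ybar k)"
    and b_step: "\<And>k. b (Suc k) = (2 *\<^sub>R x (Suc k) - xbar k)
                 - \<sigma> *\<^sub>R adjoint K (2 *\<^sub>R y (Suc k) - ybar k)"
    and d_step: "\<And>k. d (Suc k) = inv (\<lambda>u. u + (\<sigma> * \<tau>) *\<^sub>R adjoint K (K u)) (b (Suc k))"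
    and xbar_step: "\<And>k. xbar (Suc k) = xbar k - x (Suc k) + d (Suc k)"
    and ybar_step: "\<And>k. ybar (Suc k) = y (Suc k) + \<tau> *\<^sub>R K (d (Suc k))"
begin

sublocale K: bounded_linear K by (rule K)

sublocale K': bounded_linear "adjoint K" by (rule bounded_linear_adjoint[OF K])

abbreviation "domF \<equiv> effective_domain F"
abbreviation "domG \<equiv> effective_domain G"

definition f where "f u = real_of_ereal (F u)"
definition g where "g v = real_of_ereal (G v)"
definition L where "L u v = inner (K u) v + f u - g v"

lemma adjoint_swap: "inner (adjoint K v) u = inner v (K u)" "inner u (adjoint K v) = inner v (K u)"
  using adjoint_inner[OF K, of u v] by (simp_all add: inner_commute)

lemma F_eq: "u \<in> domF \<Longrightarrow> F u = ereal (f u)"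
  unfolding f_def by (rule proper_fun_finite[OF F(1)])

lemma G_eq: "v \<in> domG \<Longrightarrow> G v = ereal (g v)"
  unfolding g_def by (rule proper_fun_finite[OF G(1)])

lemma convex_f: "convex_on domF f" and convex_g: "convex_on domG g"
  using convex_on_real_of_ereal F(1,2) G(1,2) by (auto simp: f_def[abs_def] g_def[abs_def])

lemma lagrangian_eq: "u \<in> domF \<Longrightarrow> v \<in> domG \<Longrightarrow> lagrangian K F G u v = ereal (L u v)"
  by (simp add: lagrangian_def F_eq G_eq L_def)

text \<open>
  The two saddle inequalities are the cases \<open>u = p\<close> and \<open>v = q\<close> of a single one, which says that
  the primal-dual gap at \<open>(p, q)\<close> is nowhere positive. This is the form in which weak limits produce it.
\<close>

lemma saddle_point_iff:
  "saddle_point K F G p q \<longleftrightarrow> p \<in> domF \<and> q \<in> domG \<and>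
    (\<forall>u\<in>domF. \<forall>v\<in>domG. L p v \<le> L u q)"
proof
  assume "saddle_point K F G p q"
  then show "p \<in> domF \<and> q \<in> domG \<and> (\<forall>u\<in>domF. \<forall>v\<in>domG. L p v \<le> L u q)"
    unfolding saddle_point_def by (fastforce simp: lagrangian_eq)
next
  assume "p \<in> domF \<and> q \<in> domG \<and> (\<forall>u\<in>domF. \<forall>v\<in>domG. L p v \<le> L u q)"
  then show "saddle_point K F G p q"
    unfolding saddle_point_def by (auto simp: lagrangian_eq)
qed

definition dx where "dx k = xbar k - xbar (Suc k)"
definition dy where "dy k = ybar k - ybar (Suc k)"

lemma d_eq: "d (Suc k) = x (Suc k) - dx k"
  using xbar_step[of k] by (simp add: dx_def)

text \<open>
  The linear solve makes \<open>d\<close>, which is \<open>x - dx\<close>, satisfy both implicit equations at once.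
\<close>

lemma xbar_implicit: "xbar (Suc k) = x (Suc k) - \<sigma> *\<^sub>R adjoint K (y (Suc k) - dy k)"
proof -
  have "d (Suc k) + (\<sigma> * \<tau>) *\<^sub>R adjoint K (K (d (Suc k))) = b (Suc k)"
    using surj_f_inv_f[OF surj_id_plus_adjoint_comp[OF K mult_pos_pos[OF pos]], of "b (Suc k)"]
    by (simp only: d_step)
  moreover have "(\<sigma> * \<tau>) *\<^sub>R adjoint K (K (d (Suc k))) = \<sigma> *\<^sub>R adjoint K (ybar (Suc k) - y (Suc k))"
    by (simp add: ybar_step K'.scaleR)
  ultimately have "d (Suc k) = b (Suc k) - \<sigma> *\<^sub>R adjoint K (ybar (Suc k) - y (Suc k))"
    by (simp add: eq_diff_eq)
  also have "\<dots> = 2 *\<^sub>R x (Suc k) - xbar k - \<sigma> *\<^sub>R adjoint K (y (Suc k) - dy k)"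
  proof -
    have "y (Suc k) - dy k = (2 *\<^sub>R y (Suc k) - ybar k) + (ybar (Suc k) - y (Suc k))"
      by (simp add: dy_def scaleR_2)
    then show ?thesis by (simp add: b_step K'.add scaleR_add_right)
  qed
  finally have "d (Suc k) = 2 *\<^sub>R x (Suc k) - xbar k - \<sigma> *\<^sub>R adjoint K (y (Suc k) - dy k)" .
  then show ?thesis unfolding xbar_step by (simp add: scaleR_2)
qed

lemma ybar_implicit: "ybar (Suc k) = y (Suc k) + \<tau> *\<^sub>R K (x (Suc k) - dx k)"
  by (simp add: ybar_step d_eq)

lemma x_subgradient:
  shows x_in_domF: "x (Suc k) \<in> domF"
    and "p \<in> domF \<Longrightarrow> f (x (Suc k)) + inner (xbar k - x (Suc k)) (p - x (Suc k)) / \<sigma> \<le> f p"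
  using subdifferential_real[OF F(1) resolvent_subgradient[OF F pos(1), of "xbar k"]]
  by (auto simp: x_step f_def)

lemma y_subgradient:
  shows y_in_domG: "y (Suc k) \<in> domG"
    and "q \<in> domG \<Longrightarrow> g (y (Suc k)) + inner (ybar k - y (Suc k)) (q - y (Suc k)) / \<tau> \<le> g q"
  using subdifferential_real[OF G(1) resolvent_subgradient[OF G pos(2), of "ybar k"]]
  by (auto simp: y_step g_def)

section \<open>Energy estimates\<close>

text \<open>
  \<open>xbar\<close> and \<open>ybar\<close> approximate not a saddle point \<open>(p, q)\<close> but its image under the linear map
  \<open>id + T\<close>, where \<open>T (p, q) = (- \<sigma> K\<^sup>* q, \<tau> K p)\<close> is skew for the inner product weighted by
  \<open>1 / \<sigma>\<close> and \<open>1 / \<tau>\<close>.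
\<close>

definition shift_x where "shift_x p q = p - \<sigma> *\<^sub>R adjoint K q"
definition shift_y where "shift_y p q = q + \<tau> *\<^sub>R K p"

text \<open>
  Expanding \<open>xbar k - x (Suc k)\<close> and \<open>ybar k - y (Suc k)\<close> through the implicit equations, the coupling
  terms in \<open>K\<close> cancel in pairs because the primal step uses \<open>- K\<^sup>*\<close> where the dual step uses \<open>K\<close>.
\<close>

lemma one_step_identity:
  "inner (K (x (Suc k))) q - inner (K p) (y (Suc k))
     + inner (xbar k - x (Suc k)) (x (Suc k) - p) / \<sigma> + inner (ybar k - y (Suc k)) (y (Suc k) - q) / \<tau>
   = inner (dx k) (xbar (Suc k) - shift_x p q) / \<sigma> + inner (dy k) (ybar (Suc k) - shift_y p q) / \<tau>"
proof -
  have "xbar k - x (Suc k) = dx k - \<sigma> *\<^sub>R adjoint K (y (Suc k) - dy k)"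
    using xbar_implicit[of k] by (simp add: dx_def)
  then have 1: "inner (xbar k - x (Suc k)) (x (Suc k) - p) / \<sigma>
      = inner (dx k) (x (Suc k) - p) / \<sigma> - inner (y (Suc k) - dy k) (K (x (Suc k) - p))"
    using pos by (simp only: inner_diff_left[of "dx k"] inner_scaleR_left adjoint_swap diff_divide_distrib) simp
  have "ybar k - y (Suc k) = dy k + \<tau> *\<^sub>R K (x (Suc k) - dx k)"
    using ybar_implicit[of k] by (simp add: dy_def)
  then have 2: "inner (ybar k - y (Suc k)) (y (Suc k) - q) / \<tau>
      = inner (dy k) (y (Suc k) - q) / \<tau> + inner (K (x (Suc k) - dx k)) (y (Suc k) - q)"
    using pos by (simp only: inner_add_left[of "dy k"] inner_scaleR_left add_divide_distrib) simp
  have "xbar (Suc k) - shift_x p q = (x (Suc k) - p) - \<sigma> *\<^sub>R adjoint K (y (Suc k) - dy k - q)"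
    unfolding xbar_implicit shift_x_def by (simp add: K'.diff K'.add algebra_simps)
  then have 3: "inner (dx k) (xbar (Suc k) - shift_x p q) / \<sigma>
      = inner (dx k) (x (Suc k) - p) / \<sigma> - inner (y (Suc k) - dy k - q) (K (dx k))"
    using pos by (simp only: inner_diff_right[of "dx k" "_ - _"] inner_scaleR_right adjoint_swap diff_divide_distrib) simp
  have "ybar (Suc k) - shift_y p q = (y (Suc k) - q) + \<tau> *\<^sub>R K (x (Suc k) - dx k - p)"
    unfolding ybar_implicit shift_y_def by (simp add: K.diff K.add algebra_simps)
  then have 4: "inner (dy k) (ybar (Suc k) - shift_y p q) / \<tau>
      = inner (dy k) (y (Suc k) - q) / \<tau> + inner (dy k) (K (x (Suc k) - dx k - p))"
    using pos by (simp only: inner_add_right[of "dy k"] inner_scaleR_right add_divide_distrib) simp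
  \<comment> \<open>What is left after cancelling the terms in \<open>dx\<close> and \<open>dy\<close> concerns only vectors of the dual space.\<close>
  have "inner r q - inner s v - inner (v - e) (r - s) + inner (r - c) (v - q)
      = inner e (r - c - s) - inner (v - e - q) c" for r s c v e :: 'b
    by (simp add: inner_diff_left inner_diff_right inner_commute)
  from this[of "K (x (Suc k))" "K p" "y (Suc k)" "dy k" "K (dx k)"] show ?thesis
    unfolding 1 2 3 4 K.diff by linarith
qed

lemma one_step_gap:
  assumes "p \<in> domF" "q \<in> domG"
  shows "L (x (Suc k)) q - L p (y (Suc k))
    \<le> inner (dx k) (xbar (Suc k) - shift_x p q) / \<sigma> + inner (dy k) (ybar (Suc k) - shift_y p q) / \<tau>"
proof -
  have "f (x (Suc k)) - f p \<le> inner (xbar k - x (Suc k)) (x (Suc k) - p) / \<sigma>"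
    using x_subgradient(2)[OF assms(1), of k] by (simp add: inner_diff_right diff_divide_distrib)
  moreover have "g (y (Suc k)) - g q \<le> inner (ybar k - y (Suc k)) (y (Suc k) - q) / \<tau>"
    using y_subgradient(2)[OF assms(2), of k] by (simp add: inner_diff_right diff_divide_distrib)
  ultimately show ?thesis
    using one_step_identity[of k q p] by (simp add: L_def)
qed

definition energy where
  "energy k p q = (norm (xbar k - shift_x p q))\<^sup>2 / (2 * \<sigma>) + (norm (ybar k - shift_y p q))\<^sup>2 / (2 * \<tau>)"

lemma energy_nonneg: "0 \<le> energy k p q"
  using pos by (simp add: energy_def)

text \<open>
  Polarization: \<open>2 \<langle>a, c\<rangle> = \<parallel>a + c\<parallel>\<^sup>2 - \<parallel>a\<parallel>\<^sup>2 - \<parallel>c\<parallel>\<^sup>2\<close> with \<open>a = dx k\<close> and \<open>c = xbar (Suc k) - shift_x p q\<close>,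
  whose sum is \<open>xbar k - shift_x p q\<close>, and likewise for \<open>y\<close>.
\<close>

lemma one_step_energy:
  assumes "p \<in> domF" "q \<in> domG"
  shows "L (x (Suc k)) q - L p (y (Suc k))
      + ((norm (dx k))\<^sup>2 / (2 * \<sigma>) + (norm (dy k))\<^sup>2 / (2 * \<tau>)) \<le> energy k p q - energy (Suc k) p q"
proof -
  have sums: "dx k + (xbar (Suc k) - shift_x p q) = xbar k - shift_x p q" "dy k + (ybar (Suc k) - shift_y p q) = ybar k - shift_y p q"
    by (simp_all add: dx_def dy_def)
  have "inner (dx k) (xbar (Suc k) - shift_x p q) / \<sigma> + inner (dy k) (ybar (Suc k) - shift_y p q) / \<tau>
      = energy k p q - energy (Suc k) p q - ((norm (dx k))\<^sup>2 / (2 * \<sigma>) + (norm (dy k))\<^sup>2 / (2 * \<tau>))"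
    unfolding dot_norm sums energy_def using pos by (simp add: add_divide_distrib diff_divide_distrib)
  with one_step_gap[OF assms, of k] show ?thesis by linarith
qed

section \<open>The gap of the ergodic means\<close>

lemma ergodic_mean_jensen:
  assumes "k \<ge> 1"
  shows "ergodic_mean x k \<in> domF" "ergodic_mean y k \<in> domG"
    and "f (ergodic_mean x k) \<le> (\<Sum>j = 1..k. f (x j)) / real k"
    and "g (ergodic_mean y k) \<le> (\<Sum>j = 1..k. g (y j)) / real k"
proof -
  have x: "x j \<in> domF" and y: "y j \<in> domG" if "j \<in> {1..k}" for j
    using that x_in_domF[of "j - 1"] y_in_domG[of "j - 1"] by auto
  have mean: "ergodic_mean u k = (\<Sum>j = 1..k. (1 / real k) *\<^sub>R u j)" for u :: "nat \<Rightarrow> 'c::real_vector"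
    by (simp add: ergodic_mean_def scaleR_sum_right)
  have weights: "(\<Sum>j = 1..k. 1 / real k) = 1" using assms by simp
  show "ergodic_mean x k \<in> domF" "ergodic_mean y k \<in> domG"
    unfolding mean using x y weights
    by (intro convex_sum convex_on_imp_convex[OF convex_f] convex_on_imp_convex[OF convex_g]; simp)+
  show "f (ergodic_mean x k) \<le> (\<Sum>j = 1..k. f (x j)) / real k"
    using convex_on_sum[OF _ _ convex_f weights, of x] assms x by (simp add: mean sum_divide_distrib)
  show "g (ergodic_mean y k) \<le> (\<Sum>j = 1..k. g (y j)) / real k"
    using convex_on_sum[OF _ _ convex_g weights, of y] assms y by (simp add: mean sum_divide_distrib)
qed

text \<open>
  The gap is convex in the iterate for fixed \<open>(p, q)\<close>, so the gap of the mean is at most the mean of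
  the gaps, and the latter telescopes.
\<close>

lemma ergodic_gap:
  assumes "p \<in> domF" "q \<in> domG" "k \<ge> 1"
  shows "L (ergodic_mean x k) q - L p (ergodic_mean y k) \<le> energy 0 p q / real k"
proof -
  have step: "L (x (Suc j)) q - L p (y (Suc j)) \<le> energy j p q - energy (Suc j) p q" for j
  proof -
    have "0 \<le> (norm (dx j))\<^sup>2 / (2 * \<sigma>) + (norm (dy j))\<^sup>2 / (2 * \<tau>)" using pos by simp
    then show ?thesis using one_step_energy[OF assms(1,2), of j] by linarith
  qed
  have sum: "(\<Sum>j = 1..n. L (x j) q - L p (y j)) \<le> energy 0 p q - energy n p q" for n
  proof (induction n)
    case (Suc n)
    then show ?case using step[of n] by simp
  qed simp
  have Kx: "inner (K (ergodic_mean x k)) q = (\<Sum>j = 1..k. inner (K (x j)) q) / real k"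
    by (simp add: ergodic_mean_def K.scaleR K.sum inner_sum_left)
  have Ky: "inner (K p) (ergodic_mean y k) = (\<Sum>j = 1..k. inner (K p) (y j)) / real k"
    by (simp add: ergodic_mean_def inner_sum_right)
  have "L (ergodic_mean x k) q - L p (ergodic_mean y k)
      \<le> (\<Sum>j = 1..k. inner (K (x j)) q) / real k + (\<Sum>j = 1..k. f (x j)) / real k - g q
        - (\<Sum>j = 1..k. inner (K p) (y j)) / real k - f p + (\<Sum>j = 1..k. g (y j)) / real k"
    unfolding L_def Kx Ky using ergodic_mean_jensen(3,4)[OF assms(3)] by simp
  also have "\<dots> = (\<Sum>j = 1..k. L (x j) q - L p (y j)) / real k"
    using assms(3) by (simp add: L_def sum.distrib sum_subtractf add_divide_distrib diff_divide_distrib)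
  also have "\<dots> \<le> energy 0 p q / real k"
    using sum[of k] energy_nonneg[of k p q] by (intro divide_right_mono) auto
  finally show ?thesis .
qed

section \<open>Boundedness and vanishing increments\<close>

text \<open>
  At a saddle point the gap term of the energy estimate is nonnegative, so the energy decreases by at
  least the size of the increments.
\<close>

lemma saddle_energy:
  assumes "saddle_point K F G p q"
  shows "(norm (dx k))\<^sup>2 / (2 * \<sigma>) + (norm (dy k))\<^sup>2 / (2 * \<tau>) \<le> energy k p q - energy (Suc k) p q"
proof -
  have "L p (y (Suc k)) \<le> L (x (Suc k)) q" "p \<in> domF" "q \<in> domG"
    using assms x_in_domF y_in_domG by (auto simp: saddle_point_iff)
  then show ?thesis using one_step_energy[of p q k] by linarith
qed

lemma saddle_energy_decreasing:
  assumes "saddle_point K F G p q"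
  shows "decseq (\<lambda>k. energy k p q)"
proof (rule decseq_SucI)
  fix k
  have "0 \<le> (norm (dx k))\<^sup>2 / (2 * \<sigma>) + (norm (dy k))\<^sup>2 / (2 * \<tau>)" using pos by simp
  then show "energy (Suc k) p q \<le> energy k p q" using saddle_energy[OF assms, of k] by linarith
qed

lemma saddle_energy_convergent:
  assumes "saddle_point K F G p q"
  obtains e where "(\<lambda>k. energy k p q) \<longlonglongrightarrow> e"
  by (rule decseq_convergent[OF saddle_energy_decreasing[OF assms], of 0]) (use energy_nonneg in auto)

lemma increments_null:
  assumes "saddle_point K F G p q"
  shows "dx \<longlonglongrightarrow> 0" "dy \<longlonglongrightarrow> 0"
proof -
  obtain e where e: "(\<lambda>k. energy k p q) \<longlonglongrightarrow> e" by (rule saddle_energy_convergent[OF assms])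
  have lim: "(\<lambda>k. energy k p q - energy (Suc k) p q) \<longlonglongrightarrow> 0"
    using tendsto_diff[OF e LIMSEQ_Suc[OF e]] by simp
  have le: "(norm (dx k))\<^sup>2 \<le> (energy k p q - energy (Suc k) p q) * (2 * \<sigma>)"
    "(norm (dy k))\<^sup>2 \<le> (energy k p q - energy (Suc k) p q) * (2 * \<tau>)" for k
  proof -
    have "0 \<le> (norm (dx k))\<^sup>2 / (2 * \<sigma>)" "0 \<le> (norm (dy k))\<^sup>2 / (2 * \<tau>)" using pos by auto
    then have "(norm (dx k))\<^sup>2 / (2 * \<sigma>) \<le> energy k p q - energy (Suc k) p q"
      "(norm (dy k))\<^sup>2 / (2 * \<tau>) \<le> energy k p q - energy (Suc k) p q"
      using saddle_energy[OF assms, of k] by linarith+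
    then show "(norm (dx k))\<^sup>2 \<le> (energy k p q - energy (Suc k) p q) * (2 * \<sigma>)"
      "(norm (dy k))\<^sup>2 \<le> (energy k p q - energy (Suc k) p q) * (2 * \<tau>)"
      using pos by (auto simp: pos_divide_le_eq)
  qed
  have null: "u \<longlonglongrightarrow> 0" if "\<And>k. (norm (u k))\<^sup>2 \<le> (energy k p q - energy (Suc k) p q) * c"
    for u :: "nat \<Rightarrow> 'c::real_normed_vector" and c
  proof -
    have "(\<lambda>k. (norm (u k))\<^sup>2) \<longlonglongrightarrow> 0"
      by (rule Lim_null_comparison[OF _ tendsto_mult_left_zero[OF lim, of c]])
        (use that in \<open>simp add: always_eventually\<close>)
    then have "(\<lambda>k. sqrt ((norm (u k))\<^sup>2)) \<longlonglongrightarrow> sqrt 0" by (rule tendsto_real_sqrt)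
    then show ?thesis by (simp add: tendsto_norm_zero_iff)
  qed
  show "dx \<longlonglongrightarrow> 0" by (rule null) (rule le)
  show "dy \<longlonglongrightarrow> 0" by (rule null) (rule le)
qed

lemma xbar_ybar_bounded:
  assumes "saddle_point K F G p q"
  obtains R where "\<And>k. norm (xbar k) \<le> R" "\<And>k. norm (ybar k) \<le> R"
proof -
  have energy: "energy k p q \<le> energy 0 p q" for k
    using decseqD[OF saddle_energy_decreasing[OF assms], of 0 k] by simp
  have bound: "norm u \<le> norm c + sqrt (2 * t * energy 0 p q)"
    if "(norm (u - c))\<^sup>2 / (2 * t) \<le> energy 0 p q" "t > 0" for u c :: "'c::real_normed_vector" and t
  proof -
    have "(norm (u - c))\<^sup>2 \<le> 2 * t * energy 0 p q"
      using that by (simp add: pos_divide_le_eq mult_ac)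
    then have "norm (u - c) \<le> sqrt (2 * t * energy 0 p q)" by (rule real_le_rsqrt)
    then show ?thesis using norm_triangle_sub[of u c] by linarith
  qed
  have x: "(norm (xbar k - shift_x p q))\<^sup>2 / (2 * \<sigma>) \<le> energy 0 p q"
    and y: "(norm (ybar k - shift_y p q))\<^sup>2 / (2 * \<tau>) \<le> energy 0 p q" for k
  proof -
    have "0 \<le> (norm (xbar k - shift_x p q))\<^sup>2 / (2 * \<sigma>)" "0 \<le> (norm (ybar k - shift_y p q))\<^sup>2 / (2 * \<tau>)"
      using pos by auto
    then show "(norm (xbar k - shift_x p q))\<^sup>2 / (2 * \<sigma>) \<le> energy 0 p q"
      "(norm (ybar k - shift_y p q))\<^sup>2 / (2 * \<tau>) \<le> energy 0 p q"
      using energy[of k] unfolding energy_def[of k] by linarith+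
  qed
  show thesis
    by (rule that[of "max (norm (shift_x p q) + sqrt (2 * \<sigma> * energy 0 p q)) (norm (shift_y p q) + sqrt (2 * \<tau> * energy 0 p q))"])
      (use bound[OF x pos(1)] bound[OF y pos(2)] in \<open>auto simp: le_max_iff_disj\<close>)
qed

text \<open>
  Since \<open>T\<close> is skew, \<open>\<parallel>(id + T) w\<parallel>\<^sup>2 = \<parallel>w\<parallel>\<^sup>2 + \<parallel>T w\<parallel>\<^sup>2\<close> in the weighted norm. Hence the passage
  from \<open>(p, q)\<close> to its shift is injective and bounds on shifted points carry over to the original ones.
\<close>

lemma skew_shift_norm:
  "(norm u)\<^sup>2 / \<sigma> + (norm v)\<^sup>2 / \<tau> \<le> (norm (shift_x u v))\<^sup>2 / \<sigma> + (norm (shift_y u v))\<^sup>2 / \<tau>"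
proof -
  have square: "(norm (w + t *\<^sub>R z))\<^sup>2 = (norm w)\<^sup>2 + 2 * t * inner w z + t\<^sup>2 * (norm z)\<^sup>2"
    for w z :: "'c::real_inner" and t
    unfolding power2_norm_eq_inner by (simp add: inner_simps inner_commute power2_eq_square algebra_simps)
  have "(norm (shift_x u v))\<^sup>2 / \<sigma> = (norm u)\<^sup>2 / \<sigma> - 2 * inner v (K u) + \<sigma> * (norm (adjoint K v))\<^sup>2"
    using square[of u "- \<sigma>" "adjoint K v"] pos
    by (simp add: shift_x_def adjoint_swap add_divide_distrib diff_divide_distrib power2_eq_square)
  moreover have "(norm (shift_y u v))\<^sup>2 / \<tau> = (norm v)\<^sup>2 / \<tau> + 2 * inner v (K u) + \<tau> * (norm (K u))\<^sup>2"
    using square[of v \<tau> "K u"] pos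
    by (simp add: shift_y_def add_divide_distrib power2_eq_square)
  moreover have "0 \<le> \<sigma> * (norm (adjoint K v))\<^sup>2" "0 \<le> \<tau> * (norm (K u))\<^sup>2" using pos by auto
  ultimately show ?thesis by linarith
qed

lemma skew_shift_inj:
  assumes "shift_x p q = shift_x p' q'" "shift_y p q = shift_y p' q'"
  shows "p = p'" "q = q'"
proof -
  have "shift_x (p - p') (q - q') = shift_x p q - shift_x p' q'" "shift_y (p - p') (q - q') = shift_y p q - shift_y p' q'"
    by (simp_all add: shift_x_def shift_y_def K.diff K'.diff scaleR_diff_right)
  then have "(norm (p - p'))\<^sup>2 / \<sigma> + (norm (q - q'))\<^sup>2 / \<tau> \<le> 0"
    using skew_shift_norm[of "p - p'" "q - q'"] assms by simp
  moreover have "0 \<le> (norm (p - p'))\<^sup>2 / \<sigma>" "0 \<le> (norm (q - q'))\<^sup>2 / \<tau>" using pos by auto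
  ultimately have "(norm (p - p'))\<^sup>2 / \<sigma> = 0" "(norm (q - q'))\<^sup>2 / \<tau> = 0" by linarith+
  then show "p = p'" "q = q'" using pos by auto
qed

lemma shift_x_iterate: "shift_x (x (Suc k)) (y (Suc k)) = xbar (Suc k) - \<sigma> *\<^sub>R adjoint K (dy k)"
  and shift_y_iterate: "shift_y (x (Suc k)) (y (Suc k)) = ybar (Suc k) + \<tau> *\<^sub>R K (dx k)"
  by (simp_all add: shift_x_def shift_y_def xbar_implicit[of k] ybar_implicit[of k] K.diff K'.diff algebra_simps)

text \<open>
  By the implicit equations the shift of \<open>(x, y)\<close> differs from \<open>(xbar, ybar)\<close> only by a bounded
  linear image of the increments.
\<close>

lemma iterates_bounded:
  assumes "saddle_point K F G p q"
  obtains R where "\<And>k. norm (x (Suc k), y (Suc k)) \<le> R"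
proof -
  obtain R where R: "\<And>k. norm (xbar k) \<le> R" "\<And>k. norm (ybar k) \<le> R"
    by (rule xbar_ybar_bounded[OF assms]) blast
  have "norm (dx k) \<le> 2 * R" "norm (dy k) \<le> 2 * R" for k
    unfolding dx_def dy_def using norm_triangle_ineq4[of "xbar k" "xbar (Suc k)"] R(1)[of k] R(1)[of "Suc k"]
      norm_triangle_ineq4[of "ybar k" "ybar (Suc k)"] R(2)[of k] R(2)[of "Suc k"] by linarith+
  note d = this
  obtain c where c: "c > 0" "\<And>u. norm (K u) \<le> norm u * c"
    using K.pos_bounded by blast
  obtain c' where c': "c' > 0" "\<And>u. norm (adjoint K u) \<le> norm u * c'"
    using K'.pos_bounded by blast
  define A where "A = R + \<sigma> * (2 * R * c')"
  define B where "B = R + \<tau> * (2 * R * c)"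
  have A: "norm (shift_x (x (Suc k)) (y (Suc k))) \<le> A" for k
  proof -
    have "norm (adjoint K (dy k)) \<le> 2 * R * c'"
      using c'(2)[of "dy k"] mult_right_mono[OF d(2)[of k], of c'] c'(1) by linarith
    then have "norm (\<sigma> *\<^sub>R adjoint K (dy k)) \<le> \<sigma> * (2 * R * c')" using pos by simp
    then show ?thesis
      unfolding shift_x_iterate A_def using norm_triangle_ineq4[of "xbar (Suc k)" "\<sigma> *\<^sub>R adjoint K (dy k)"] R(1)[of "Suc k"]
      by linarith
  qed
  have B: "norm (shift_y (x (Suc k)) (y (Suc k))) \<le> B" for k
  proof -
    have "norm (K (dx k)) \<le> 2 * R * c"
      using c(2)[of "dx k"] mult_right_mono[OF d(1)[of k], of c] c(1) by linarith
    then have "norm (\<tau> *\<^sub>R K (dx k)) \<le> \<tau> * (2 * R * c)" using pos by simp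
    then show ?thesis
      unfolding shift_y_iterate B_def using norm_triangle_ineq[of "ybar (Suc k)" "\<tau> *\<^sub>R K (dx k)"] R(2)[of "Suc k"]
      by linarith
  qed
  define C where "C = A\<^sup>2 / \<sigma> + B\<^sup>2 / \<tau>"
  have C: "(norm (x (Suc k)))\<^sup>2 / \<sigma> + (norm (y (Suc k)))\<^sup>2 / \<tau> \<le> C" for k
    unfolding C_def
    by (rule order_trans[OF skew_shift_norm], intro add_mono divide_right_mono power_mono A B)
      (use pos in auto)
  have "norm (x (Suc k), y (Suc k)) \<le> sqrt (\<sigma> * C) + sqrt (\<tau> * C)" for k
  proof -
    have "0 \<le> (norm (x (Suc k)))\<^sup>2 / \<sigma>" "0 \<le> (norm (y (Suc k)))\<^sup>2 / \<tau>" using pos by auto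
    then have "(norm (x (Suc k)))\<^sup>2 / \<sigma> \<le> C" "(norm (y (Suc k)))\<^sup>2 / \<tau> \<le> C" using C[of k] by linarith+
    then have "(norm (x (Suc k)))\<^sup>2 \<le> \<sigma> * C" "(norm (y (Suc k)))\<^sup>2 \<le> \<tau> * C"
      using pos by (auto simp: pos_divide_le_eq mult.commute)
    then have "norm (x (Suc k)) \<le> sqrt (\<sigma> * C)" "norm (y (Suc k)) \<le> sqrt (\<tau> * C)"
      by (auto intro: real_le_rsqrt)
    then show ?thesis using norm_Pair_le[of "x (Suc k)" "y (Suc k)"] by linarith
  qed
  then show thesis by (rule that)
qed

section \<open>Weak cluster points of the iterates\<close>

text \<open>
  The index is shifted because \<open>x 0\<close> and \<open>y 0\<close> are arbitrary and unrelated to the iteration.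
\<close>

definition weak_cluster_point where
  "weak_cluster_point \<Psi> p q \<longleftrightarrow> \<Psi> \<le> sequentially \<and> \<Psi> \<noteq> bot \<and>
     (\<forall>v. ((\<lambda>n. inner (x (Suc n), y (Suc n)) v) \<longlongrightarrow> inner (p, q) v) \<Psi>)"

lemma weak_cluster_pointD:
  assumes "weak_cluster_point \<Psi> p q"
  shows "\<Psi> \<le> sequentially" "\<Psi> \<noteq> bot"
    and "((\<lambda>n. inner (x (Suc n)) u) \<longlongrightarrow> inner p u) \<Psi>"
    and "((\<lambda>n. inner (y (Suc n)) v) \<longlongrightarrow> inner q v) \<Psi>"
proof -
  have lim: "((\<lambda>n. inner (x (Suc n), y (Suc n)) w) \<longlongrightarrow> inner (p, q) w) \<Psi>" for w
    using assms unfolding weak_cluster_point_def by blast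
  show "\<Psi> \<le> sequentially" "\<Psi> \<noteq> bot"
    using assms by (auto simp: weak_cluster_point_def)
  show "((\<lambda>n. inner (x (Suc n)) u) \<longlongrightarrow> inner p u) \<Psi>" using lim[of "(u, 0)"] by simp
  show "((\<lambda>n. inner (y (Suc n)) v) \<longlongrightarrow> inner q v) \<Psi>" using lim[of "(0, v)"] by simp
qed

text \<open>
  The weak limit of the one-step gap estimate. Strict lower bounds \<open>\<alpha>\<close> and \<open>\<beta>\<close> stand for \<open>F p\<close> and
  \<open>G q\<close>, whose finiteness is only a consequence of this inequality.
\<close>

lemma weak_cluster_point_inequality:
  assumes saddle: "saddle_point K F G p0 q0" and cluster: "weak_cluster_point \<Psi> p q"
    and uv: "u \<in> domF" "v \<in> domG" and less: "ereal \<alpha> < F p" "ereal \<beta> < G q"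
  shows "inner (K p) v + \<alpha> - g v \<le> inner (K u) q + f u - \<beta>"
proof -
  note \<Psi> = weak_cluster_pointD[OF cluster]
  obtain R where R: "\<And>k. norm (xbar k) \<le> R" "\<And>k. norm (ybar k) \<le> R"
    by (rule xbar_ybar_bounded[OF saddle]) blast
  have zx: "norm (xbar (Suc k) - shift_x u v) \<le> R + norm (shift_x u v)"
    and zy: "norm (ybar (Suc k) - shift_y u v) \<le> R + norm (shift_y u v)" for k
    using norm_triangle_ineq4[of "xbar (Suc k)" "shift_x u v"] norm_triangle_ineq4[of "ybar (Suc k)" "shift_y u v"]
      R(1)[of "Suc k"] R(2)[of "Suc k"] by linarith+
  define r where "r = (\<lambda>n. inner (dx n) (xbar (Suc n) - shift_x u v) / \<sigma> + inner (dy n) (ybar (Suc n) - shift_y u v) / \<tau>)"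
  have "((\<lambda>n. inner (dx n) (xbar (Suc n) - shift_x u v)) \<longlonglongrightarrow> 0)"
    by (rule tendsto_inner_null_bounded[OF increments_null(1)[OF saddle] zx])
  moreover have "((\<lambda>n. inner (dy n) (ybar (Suc n) - shift_y u v)) \<longlonglongrightarrow> 0)"
    by (rule tendsto_inner_null_bounded[OF increments_null(2)[OF saddle] zy])
  ultimately have "r \<longlonglongrightarrow> 0 / \<sigma> + 0 / \<tau>"
    unfolding r_def using pos by (intro tendsto_add tendsto_divide tendsto_const) auto
  then have r: "(r \<longlongrightarrow> 0) \<Psi>"
    using tendsto_mono[OF \<Psi>(1)] by simp
  have "((\<lambda>n. inner (K (x (Suc n))) v) \<longlongrightarrow> inner (K p) v) \<Psi>"
    using \<Psi>(3)[of "adjoint K v"] by (simp add: adjoint_swap inner_commute)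
  moreover have "((\<lambda>n. inner (K u) (y (Suc n))) \<longlongrightarrow> inner (K u) q) \<Psi>"
    using \<Psi>(4)[of "K u"] by (simp add: inner_commute)
  ultimately have lim: "((\<lambda>n. inner (K (x (Suc n))) v + \<alpha> - g v - (inner (K u) (y (Suc n)) + f u - \<beta>))
      \<longlongrightarrow> inner (K p) v + \<alpha> - g v - (inner (K u) q + f u - \<beta>)) \<Psi>"
    by (intro tendsto_add tendsto_diff tendsto_const)
  have "eventually (\<lambda>n. ereal \<alpha> < F (x (Suc n))) \<Psi>"
    using \<Psi>(3) less(1) by (rule convex_weakly_lower_semicontinuous[OF F(2,3)])
  moreover have "eventually (\<lambda>n. ereal \<beta> < G (y (Suc n))) \<Psi>"
    using \<Psi>(4) less(2) by (rule convex_weakly_lower_semicontinuous[OF G(2,3)])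
  ultimately have "eventually (\<lambda>n. inner (K (x (Suc n))) v + \<alpha> - g v
      - (inner (K u) (y (Suc n)) + f u - \<beta>) \<le> r n) \<Psi>"
  proof eventually_elim
    case (elim n)
    then have "\<alpha> < f (x (Suc n))" "\<beta> < g (y (Suc n))"
      using F_eq[OF x_in_domF[of n]] G_eq[OF y_in_domG[of n]] by simp_all
    then show ?case
      using one_step_gap[OF uv, of n] by (simp add: L_def r_def)
  qed
  then have "inner (K p) v + \<alpha> - g v - (inner (K u) q + f u - \<beta>) \<le> 0"
    by (rule tendsto_le[OF \<Psi>(2) r lim])
  then show ?thesis by simp
qed

text \<open>
  If \<open>F p\<close> were infinite, \<open>\<alpha>\<close> could be arbitrarily large in the preceding inequality, and similarly
  for \<open>G q\<close>; once both are finite, \<open>\<alpha>\<close> and \<open>\<beta>\<close> tend to them.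
\<close>

lemma weak_cluster_point_saddle:
  assumes saddle: "saddle_point K F G p0 q0" and cluster: "weak_cluster_point \<Psi> p q"
  shows "saddle_point K F G p q"
proof -
  note ineq = weak_cluster_point_inequality[OF saddle cluster]
  have dom0: "p0 \<in> domF" "q0 \<in> domG" using saddle by (auto simp: saddle_point_iff)
  have "F p \<noteq> - \<infinity>" "G q \<noteq> - \<infinity>" using F(1) G(1) by (auto simp: proper_fun_def)
  then obtain \<alpha>0 \<beta>0 where below: "ereal \<alpha>0 < F p" "ereal \<beta>0 < G q"
    using ereal_dense2[of "- \<infinity>" "F p"] ereal_dense2[of "- \<infinity>" "G q"] by auto
  have "p \<in> domF"
  proof (rule ccontr)
    assume "p \<notin> domF"
    then have "ereal \<alpha> < F p" for \<alpha> by (simp add: effective_domain_def)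
    from ineq[OF dom0 this below(2), of "inner (K p0) q + f p0 - \<beta>0 - inner (K p) q0 + g q0 + 1"]
    show False by simp
  qed
  moreover have "q \<in> domG"
  proof (rule ccontr)
    assume "q \<notin> domG"
    then have "ereal \<beta> < G q" for \<beta> by (simp add: effective_domain_def)
    from ineq[OF dom0 below(1) this, of "inner (K p0) q + f p0 - \<alpha>0 - inner (K p) q0 + g q0 + 1"]
    show False by simp
  qed
  moreover have "L p v \<le> L u q" if uv: "u \<in> domF" "v \<in> domG" for u v
  proof (rule field_le_epsilon)
    fix e :: real assume e: "e > 0"
    have "ereal (f p - e / 2) < F p" "ereal (g q - e / 2) < G q"
      using F_eq[OF \<open>p \<in> domF\<close>] G_eq[OF \<open>q \<in> domG\<close>] e by simp_all
    from ineq[OF uv this] show "L p v \<le> L u q + e" by (simp add: L_def)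
  qed
  ultimately show ?thesis by (simp add: saddle_point_iff)
qed

text \<open>
  The increments tend to zero in norm, so weak limits pass through the implicit equations.
\<close>

lemma weak_cluster_point_shifted:
  assumes saddle: "saddle_point K F G p0 q0" and cluster: "weak_cluster_point \<Psi> p q"
  shows "((\<lambda>n. inner (xbar (Suc n)) u) \<longlongrightarrow> inner (shift_x p q) u) \<Psi>"
    and "((\<lambda>n. inner (ybar (Suc n)) v) \<longlongrightarrow> inner (shift_y p q) v) \<Psi>"
proof -
  note \<Psi> = weak_cluster_pointD[OF cluster]
  have dx: "(dx \<longlongrightarrow> 0) \<Psi>" and dy: "(dy \<longlongrightarrow> 0) \<Psi>"
    using increments_null[OF saddle] tendsto_mono[OF \<Psi>(1)] by auto
  have "((\<lambda>n. inner (x (Suc n)) u - \<sigma> * inner (y (Suc n)) (K u) + \<sigma> * inner (dy n) (K u))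
      \<longlongrightarrow> inner p u - \<sigma> * inner q (K u) + \<sigma> * inner 0 (K u)) \<Psi>"
    by (intro tendsto_intros \<Psi> dy)
  then show "((\<lambda>n. inner (xbar (Suc n)) u) \<longlongrightarrow> inner (shift_x p q) u) \<Psi>"
    by (simp add: xbar_implicit shift_x_def K'.diff inner_diff_left inner_add_left adjoint_swap algebra_simps)
  have "((\<lambda>n. inner (y (Suc n)) v + \<tau> * inner (x (Suc n)) (adjoint K v) - \<tau> * inner (dx n) (adjoint K v))
      \<longlongrightarrow> inner q v + \<tau> * inner p (adjoint K v) - \<tau> * inner 0 (adjoint K v)) \<Psi>"
    by (intro tendsto_intros \<Psi> dx)
  then show "((\<lambda>n. inner (ybar (Suc n)) v) \<longlongrightarrow> inner (shift_y p q) v) \<Psi>"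
    by (simp add: ybar_implicit shift_y_def K.diff inner_diff_left inner_add_left adjoint_swap
        inner_commute[of v] algebra_simps)
qed

lemma energy_difference:
  "energy k p q - energy k p' q' = inner (xbar k) (shift_x p' q' - shift_x p q) / \<sigma> + inner (ybar k) (shift_y p' q' - shift_y p q) / \<tau>
     + ((norm (shift_x p q))\<^sup>2 - (norm (shift_x p' q'))\<^sup>2) / (2 * \<sigma>) + ((norm (shift_y p q))\<^sup>2 - (norm (shift_y p' q'))\<^sup>2) / (2 * \<tau>)"
proof -
  have "((norm (z - a))\<^sup>2 - (norm (z - a'))\<^sup>2) / (2 * t)
      = inner z (a' - a) / t + ((norm a)\<^sup>2 - (norm a')\<^sup>2) / (2 * t)"
    if "t > 0" for z a a' :: "'c::real_inner" and t
  proof -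
    have "(norm (z - a))\<^sup>2 - (norm (z - a'))\<^sup>2 = 2 * inner z (a' - a) + ((norm a)\<^sup>2 - (norm a')\<^sup>2)"
      unfolding power2_norm_eq_inner by (simp add: inner_diff_left inner_diff_right inner_commute)
    then show ?thesis by (simp add: add_divide_distrib)
  qed
  from this[OF pos(1), of "xbar k" "shift_x p q" "shift_x p' q'"] this[OF pos(2), of "ybar k" "shift_y p q" "shift_y p' q'"]
  show ?thesis unfolding energy_def diff_divide_distrib by linarith
qed

text \<open>
  Opial's argument. Both cluster points are saddle points, so both energies converge, and with them
  the affine function \<open>h\<close> of \<open>(xbar, ybar)\<close>. Its limits along the two filters differ by the weighted
  squared distance of the shifted points, which is therefore zero.
\<close>

lemma weak_cluster_point_unique:
  assumes saddle: "saddle_point K F G p0 q0"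
    and 1: "weak_cluster_point \<Psi> p q" and 2: "weak_cluster_point \<Psi>' p' q'"
  shows "p = p'" "q = q'"
proof -
  define h where "h = (\<lambda>n. inner (xbar (Suc n)) (shift_x p' q' - shift_x p q) / \<sigma> + inner (ybar (Suc n)) (shift_y p' q' - shift_y p q) / \<tau>)"
  obtain e e' where e: "(\<lambda>k. energy k p q) \<longlonglongrightarrow> e" "(\<lambda>k. energy k p' q') \<longlonglongrightarrow> e'"
    using saddle_energy_convergent[OF weak_cluster_point_saddle[OF saddle 1]]
      saddle_energy_convergent[OF weak_cluster_point_saddle[OF saddle 2]] by metis
  define c where "c = e - e' - ((norm (shift_x p q))\<^sup>2 - (norm (shift_x p' q'))\<^sup>2) / (2 * \<sigma>) - ((norm (shift_y p q))\<^sup>2 - (norm (shift_y p' q'))\<^sup>2) / (2 * \<tau>)"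
  have h_eq: "h = (\<lambda>n. energy (Suc n) p q - energy (Suc n) p' q' - ((norm (shift_x p q))\<^sup>2 - (norm (shift_x p' q'))\<^sup>2) / (2 * \<sigma>)
      - ((norm (shift_y p q))\<^sup>2 - (norm (shift_y p' q'))\<^sup>2) / (2 * \<tau>))"
    unfolding h_def energy_difference by simp
  have "h \<longlonglongrightarrow> c"
    unfolding h_eq c_def by (intro tendsto_diff tendsto_const e[THEN LIMSEQ_Suc])
  then have c: "(h \<longlongrightarrow> c) \<Psi>" "(h \<longlongrightarrow> c) \<Psi>'"
    using tendsto_mono[OF weak_cluster_pointD(1)[OF 1]] tendsto_mono[OF weak_cluster_pointD(1)[OF 2]] by auto
  have "(h \<longlongrightarrow> inner (shift_x p q) (shift_x p' q' - shift_x p q) / \<sigma> + inner (shift_y p q) (shift_y p' q' - shift_y p q) / \<tau>) \<Psi>"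
    unfolding h_def using pos
    by (intro tendsto_add tendsto_divide tendsto_const weak_cluster_point_shifted[OF saddle 1]) auto
  then have "c = inner (shift_x p q) (shift_x p' q' - shift_x p q) / \<sigma> + inner (shift_y p q) (shift_y p' q' - shift_y p q) / \<tau>"
    using tendsto_unique[OF weak_cluster_pointD(2)[OF 1] c(1)] by simp
  moreover have "(h \<longlongrightarrow> inner (shift_x p' q') (shift_x p' q' - shift_x p q) / \<sigma> + inner (shift_y p' q') (shift_y p' q' - shift_y p q) / \<tau>) \<Psi>'"
    unfolding h_def using pos
    by (intro tendsto_add tendsto_divide tendsto_const weak_cluster_point_shifted[OF saddle 2]) auto
  then have "c = inner (shift_x p' q') (shift_x p' q' - shift_x p q) / \<sigma> + inner (shift_y p' q') (shift_y p' q' - shift_y p q) / \<tau>"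
    using tendsto_unique[OF weak_cluster_pointD(2)[OF 2] c(2)] by simp
  ultimately have "(norm (shift_x p' q' - shift_x p q))\<^sup>2 / \<sigma> + (norm (shift_y p' q' - shift_y p q))\<^sup>2 / \<tau> = 0"
    unfolding power2_norm_eq_inner inner_diff_left[of _ _ "_ - _"] diff_divide_distrib by linarith
  moreover have "0 \<le> (norm (shift_x p' q' - shift_x p q))\<^sup>2 / \<sigma>" "0 \<le> (norm (shift_y p' q' - shift_y p q))\<^sup>2 / \<tau>" using pos by auto
  ultimately have "(norm (shift_x p' q' - shift_x p q))\<^sup>2 / \<sigma> = 0" "(norm (shift_y p' q' - shift_y p q))\<^sup>2 / \<tau> = 0" by linarith+
  then have "shift_x p q = shift_x p' q'" "shift_y p q = shift_y p' q'" using pos by auto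
  then show "p = p'" "q = q'" by (rule skew_shift_inj)+
qed

lemma weak_convergence_to_saddle:
  assumes saddle: "saddle_point K F G p0 q0"
  obtains p q where "saddle_point K F G p q" "weakly_converges_to (\<lambda>k. (x k, y k)) (p, q)"
proof -
  obtain R where R: "\<And>k. norm (x (Suc k), y (Suc k)) \<le> R"
    by (rule iterates_bounded[OF saddle]) blast
  obtain l \<Psi> where l: "\<Psi> \<le> sequentially" "\<Psi> \<noteq> bot"
      "\<And>v. ((\<lambda>n. inner (x (Suc n), y (Suc n)) v) \<longlongrightarrow> inner l v) \<Psi>"
      "weakly_converges_to (\<lambda>n. (x (Suc n), y (Suc n))) l"
  proof (rule weak_convergence_if_unique_cluster_point[of "\<lambda>n. (x (Suc n), y (Suc n))" R])
    fix \<Psi> l \<Psi>' l'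
    assume "\<Psi> \<le> sequentially" "\<Psi> \<noteq> bot" "\<And>v. ((\<lambda>n. inner (x (Suc n), y (Suc n)) v) \<longlongrightarrow> inner l v) \<Psi>"
      "\<Psi>' \<le> sequentially" "\<Psi>' \<noteq> bot" "\<And>v. ((\<lambda>n. inner (x (Suc n), y (Suc n)) v) \<longlongrightarrow> inner l' v) \<Psi>'"
    then have "weak_cluster_point \<Psi> (fst l) (snd l)" "weak_cluster_point \<Psi>' (fst l') (snd l')"
      unfolding weak_cluster_point_def prod.collapse by blast+
    from weak_cluster_point_unique[OF saddle this] show "l = l'" by (simp add: prod_eq_iff)
  qed (use R in auto)
  have "weak_cluster_point \<Psi> (fst l) (snd l)"
    using l(1-3) unfolding weak_cluster_point_def prod.collapse by blast
  then have "saddle_point K F G (fst l) (snd l)"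
    by (rule weak_cluster_point_saddle[OF saddle])
  moreover have "weakly_converges_to (\<lambda>k. (x k, y k)) (fst l, snd l)"
    using l(4) unfolding weakly_converges_to_def
    using filterlim_sequentially_Suc[of "\<lambda>k. _ (x k, y k)"] by auto
  ultimately show thesis by (rule that)
qed

section \<open>The gap bound and the convergence theorem\<close>

lemma gap_bound_eq_energy:
  "gap_bound K \<sigma> \<tau> (xbar 0) (ybar 0) X0 Y0 k
    = ereal (1 / real k) * (SUP (p, q)\<in>X0 \<times> Y0. ereal (energy 0 p q))"
  by (simp add: gap_bound_def energy_def shift_x_def shift_y_def algebra_simps)

lemma restricted_gap_le:
  assumes "X0 \<subseteq> domF" "Y0 \<subseteq> domG" "k \<ge> 1"
  shows "restricted_gap K F G X0 Y0 (ergodic_mean x k) (ergodic_mean y k)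
    \<le> gap_bound K \<sigma> \<tau> (xbar 0) (ybar 0) X0 Y0 k"
  unfolding restricted_gap_def
proof (rule SUP_least, clarify)
  fix p q assume pq: "p \<in> X0" "q \<in> Y0"
  then have dom: "p \<in> domF" "q \<in> domG" using assms by auto
  have "lagrangian K F G (ergodic_mean x k) q - lagrangian K F G p (ergodic_mean y k)
      = ereal (L (ergodic_mean x k) q - L p (ergodic_mean y k))"
    using ergodic_mean_jensen(1,2)[OF assms(3)] dom by (simp add: lagrangian_eq)
  also have "\<dots> \<le> ereal (1 / real k) * ereal (energy 0 p q)"
    using ergodic_gap[OF dom assms(3)] by simp
  also have "\<dots> \<le> ereal (1 / real k) * (SUP (p, q)\<in>X0 \<times> Y0. ereal (energy 0 p q))"
    using pq by (intro ereal_mult_left_mono SUP_upper2[of "(p, q)"]) auto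
  finally show "lagrangian K F G (ergodic_mean x k) q - lagrangian K F G p (ergodic_mean y k)
      \<le> gap_bound K \<sigma> \<tau> (xbar 0) (ybar 0) X0 Y0 k"
    by (simp only: gap_bound_eq_energy)
qed

lemma energy_sup_finite:
  assumes "bounded X0" "bounded Y0" "X0 \<times> Y0 \<noteq> {}"
  shows "\<bar>SUP (p, q)\<in>X0 \<times> Y0. ereal (energy 0 p q)\<bar> \<noteq> \<infinity>"
proof -
  obtain p0 q0 where pq0: "p0 \<in> X0" "q0 \<in> Y0" using assms(3) by auto
  have "bounded ((\<lambda>(p, q). shift_x p q) ` (X0 \<times> Y0))"
  proof -
    have "bounded ((\<lambda>z. fst z - \<sigma> *\<^sub>R adjoint K (snd z)) ` (X0 \<times> Y0))"
      by (intro bounded_linear_image bounded_Times assms bounded_linear_sub bounded_linear_fst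
          bounded_linear_const_scaleR bounded_linear_compose[OF K'.bounded_linear_axioms] bounded_linear_snd)
    then show ?thesis by (simp add: shift_x_def case_prod_beta)
  qed
  then obtain A where A: "\<And>p q. p \<in> X0 \<Longrightarrow> q \<in> Y0 \<Longrightarrow> norm (shift_x p q) \<le> A"
    unfolding bounded_iff by auto
  have "bounded ((\<lambda>(p, q). shift_y p q) ` (X0 \<times> Y0))"
  proof -
    have "bounded ((\<lambda>z. snd z + \<tau> *\<^sub>R K (fst z)) ` (X0 \<times> Y0))"
      by (intro bounded_linear_image bounded_Times assms bounded_linear_add bounded_linear_fst
          bounded_linear_const_scaleR bounded_linear_compose[OF K] bounded_linear_snd)
    then show ?thesis by (simp add: shift_y_def case_prod_beta)
  qed
  then obtain B where B: "\<And>p q. p \<in> X0 \<Longrightarrow> q \<in> Y0 \<Longrightarrow> norm (shift_y p q) \<le> B"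
    unfolding bounded_iff by auto
  define C where "C = (norm (xbar 0) + A)\<^sup>2 / (2 * \<sigma>) + (norm (ybar 0) + B)\<^sup>2 / (2 * \<tau>)"
  have C: "energy 0 p q \<le> C" if "p \<in> X0" "q \<in> Y0" for p q
  proof -
    have "norm (xbar 0 - shift_x p q) \<le> norm (xbar 0) + A" "norm (ybar 0 - shift_y p q) \<le> norm (ybar 0) + B"
      using norm_triangle_ineq4[of "xbar 0" "shift_x p q"] norm_triangle_ineq4[of "ybar 0" "shift_y p q"]
        A[OF that] B[OF that] by linarith+
    then show ?thesis
      unfolding energy_def C_def using pos by (intro add_mono divide_right_mono power_mono) auto
  qed
  have "(SUP (p, q)\<in>X0 \<times> Y0. ereal (energy 0 p q)) \<le> ereal C"
    using C by (auto intro!: SUP_least)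
  moreover have "ereal (energy 0 p0 q0) \<le> (SUP (p, q)\<in>X0 \<times> Y0. ereal (energy 0 p q))"
    using pq0 by (intro SUP_upper2[of "(p0, q0)"]) auto
  ultimately show ?thesis
    by (cases "SUP (p, q)\<in>X0 \<times> Y0. ereal (energy 0 p q)") auto
qed

end

theorem theorem1:
  fixes K :: "'a::{real_inner, complete_space} \<Rightarrow> 'b::{real_inner, complete_space}"
    and F :: "'a \<Rightarrow> ereal" and G :: "'b \<Rightarrow> ereal"
    and X0 :: "'a set" and Y0 :: "'b set"
    and \<sigma> \<tau> :: real
    and x xbar b d :: "nat \<Rightarrow> 'a" and y ybar :: "nat \<Rightarrow> 'b"
  assumes "bounded_linear K"
    and "proper_fun F" "convex_fun F" "lower_semicontinuous F"
    and "proper_fun G" "convex_fun G" "lower_semicontinuous G"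
    and "X0 \<subseteq> effective_domain F" "bounded X0"
    and "Y0 \<subseteq> effective_domain G" "bounded Y0"
    and "\<exists>(xs, ys)\<in>X0 \<times> Y0. saddle_point K F G xs ys"
    and "\<sigma> > 0" "\<tau> > 0"
    and "\<And>k. x (Suc k) = resolvent \<sigma> (subdifferential F) (xbar k)"
    and "\<And>k. y (Suc k) = resolvent \<tau> (subdifferential G) (ybar k)"
    and "\<And>k. b (Suc k) = (2 *\<^sub>R x (Suc k) - xbar k)
                 - \<sigma> *\<^sub>R adjoint K (2 *\<^sub>R y (Suc k) - ybar k)"
    and "\<And>k. d (Suc k) = inv (\<lambda>u. u + (\<sigma> * \<tau>) *\<^sub>R adjoint K (K u)) (b (Suc k))"
    and "\<And>k. xbar (Suc k) = xbar k - x (Suc k) + d (Suc k)"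
    and "\<And>k. ybar (Suc k) = y (Suc k) + \<tau> *\<^sub>R K (d (Suc k))"
  shows "(\<exists>xs ys. saddle_point K F G xs ys
            \<and> weakly_converges_to (\<lambda>k. (x k, y k)) (xs, ys)
            \<and> weakly_converges_to (ergodic_mean x) xs
            \<and> weakly_converges_to (ergodic_mean y) ys)
       \<and> (\<forall>k\<ge>1. restricted_gap K F G X0 Y0 (ergodic_mean x k) (ergodic_mean y k)
                  \<le> gap_bound K \<sigma> \<tau> (xbar 0) (ybar 0) X0 Y0 k)
       \<and> (\<forall>k\<ge>1. \<bar>gap_bound K \<sigma> \<tau> (xbar 0) (ybar 0) X0 Y0 k\<bar> \<noteq> \<infinity>)
       \<and> (\<lambda>k. real_of_ereal (gap_bound K \<sigma> \<tau> (xbar 0) (ybar 0) X0 Y0 k))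
            \<in> O(\<lambda>k. 1 / real k)"
proof -
  interpret douglas_rachford K F G \<sigma> \<tau> x xbar b d y ybar
    by (rule douglas_rachford.intro) (rule assms)+
  obtain p0 q0 where pq0: "p0 \<in> X0" "q0 \<in> Y0" "saddle_point K F G p0 q0"
    using assms(12) by auto
  obtain p q where pq: "saddle_point K F G p q" "weakly_converges_to (\<lambda>k. (x k, y k)) (p, q)"
    by (rule weak_convergence_to_saddle[OF pq0(3)])
  have "weakly_converges_to x p" "weakly_converges_to y q"
    unfolding weakly_converges_to_def
  proof safe
    fix \<phi> :: "'a \<Rightarrow> real" assume "bounded_linear \<phi>"
    then have "bounded_linear (\<lambda>z::'a \<times> 'b. \<phi> (fst z))"
      by (rule bounded_linear_compose) (rule bounded_linear_fst)
    then show "(\<lambda>n. \<phi> (x n)) \<longlonglongrightarrow> \<phi> p"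
      using pq(2) unfolding weakly_converges_to_def by fastforce
  next
    fix \<phi> :: "'b \<Rightarrow> real" assume "bounded_linear \<phi>"
    then have "bounded_linear (\<lambda>z::'a \<times> 'b. \<phi> (snd z))"
      by (rule bounded_linear_compose) (rule bounded_linear_snd)
    then show "(\<lambda>n. \<phi> (y n)) \<longlonglongrightarrow> \<phi> q"
      using pq(2) unfolding weakly_converges_to_def by fastforce
  qed
  then have ergodic: "weakly_converges_to (ergodic_mean x) p" "weakly_converges_to (ergodic_mean y) q"
    by (simp_all add: weakly_converges_to_ergodic_mean)
  define S where "S = (SUP (p, q)\<in>X0 \<times> Y0. ereal (energy 0 p q))"
  have bound: "gap_bound K \<sigma> \<tau> (xbar 0) (ybar 0) X0 Y0 k = ereal (1 / real k) * S" for k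
    by (simp add: gap_bound_eq_energy S_def)
  have "\<bar>S\<bar> \<noteq> \<infinity>"
    unfolding S_def using assms pq0 by (intro energy_sup_finite) auto
  then obtain s where s: "S = ereal s" by auto
  have "(\<lambda>k. real_of_ereal (gap_bound K \<sigma> \<tau> (xbar 0) (ybar 0) X0 Y0 k)) \<in> O(\<lambda>k. 1 / real k)"
    by (rule bigoI[of _ "\<bar>s\<bar>"]) (simp add: bound s)
  with pq ergodic restricted_gap_le[OF assms(8,10)] show ?thesis
    by (auto simp: bound s)
qed

end
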